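(* Let $E$ be a complex Banach lattice and let $T \in \mathcal{L}(E)$ be positive with spectral radius $r(T) = 1$. Suppose that $\lambda \in \sigma_{\mathrm{per}}(T)$ is an eigenvalue of $T$ and that $z \in E$ is a corresponding eigenvector with norm $\|z\| = 1$. Let $(r_n)_{n\in\mathbb{N}}$ be a sequence of real numbers with $1 < r_n \downarrow 1$. Then the following holds: (a) For each index $n$ we have $\frac{1}{r_n-1} \le \|R(r_n,T)|z|\| \le \|R(r_n,T)\|$. (b) If $\|R(r_n,T)|z|\| \sim \frac{1}{r_n-1}$, then $\lambda^k \in \sigma(T)$ for all $k \in \mathbb{Z}$. (c) If $\|R(r_n,T)|z|\| \sim \|R(r_n,T)\|$, then $\lambda^k \in \sigma(T)$ for all $k \in \mathbb{Z}$.
   Context: $\mathcal{L}(E)$ is the space of bounded linear operators on $E$. $T$ is positive if $Tx \ge 0$ whenever $x \ge 0$. $\sigma(T)$ is the spectrum and $r(T)$ the spectral radius of $T$; the peripheral spectrum is $\sigma_{\mathrm{per}}(T) := \{\lambda \in \sigma(T) : |\lambda| = r(T)\}$. $R(\mu,T) := (\mu - T)^{-1}$ denotes the resolvent. $|z|$ is the lattice modulus of $z$. For sequences $(a_n),(b_n)$ of non-negative real numbers, $a_n \sim b_n$ means $a_n = O(b_n)$ and $b_n = O(a_n)$ as $n\to\infty$. The notation $1 < r_n \downarrow 1$ means that all $r_n>1$ and $(r_n)$ decreases to $1$. *)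

theory Defs
  imports "HOL-Analysis.Analysis" "HOL-Library.Lattice_Algebras" "HOL-Library.Landau_Symbols"
begin

section \<open>Real Banach lattices\<close>

class banach_lattice = banach + ordered_real_vector + lattice_ab_group_add_abs +
  assumes norm_lattice_mono: "\<bar>x\<bar> \<le> \<bar>y\<bar> \<Longrightarrow> norm x \<le> norm y"

instance real :: banach_lattice
  by standard (auto simp: sup_real_def)

lemma norm_mono_nonneg:
  fixes x y :: "'a::banach_lattice"
  shows "0 \<le> x \<Longrightarrow> x \<le> y \<Longrightarrow> norm x \<le> norm y"
  by (metis abs_of_nonneg norm_lattice_mono order_trans)

lemma norm_abs:
  fixes x :: "'a::banach_lattice"
  shows "norm \<bar>x\<bar> = norm x"
  using norm_lattice_mono[of x "\<bar>x\<bar>"] norm_lattice_mono[of "\<bar>x\<bar>" x] by simp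

lemma abs_scaleR_lattice:
  fixes x :: "'a::banach_lattice"
  shows "\<bar>a *\<^sub>R x\<bar> \<le> \<bar>a\<bar> *\<^sub>R \<bar>x\<bar>"
proof (cases "a \<ge> 0")
  case True
  then have "a *\<^sub>R x \<le> a *\<^sub>R \<bar>x\<bar>" "a *\<^sub>R (- x) \<le> a *\<^sub>R \<bar>x\<bar>"
    by (intro scaleR_left_mono; simp add: abs_ge_self abs_ge_minus_self)+
  then show ?thesis using True by (simp add: abs_le_iff)
next
  case False
  then have "(- a) *\<^sub>R x \<le> (- a) *\<^sub>R \<bar>x\<bar>" "(- a) *\<^sub>R (- x) \<le> (- a) *\<^sub>R \<bar>x\<bar>"
    by (intro scaleR_left_mono; simp add: abs_ge_self abs_ge_minus_self)+
  then show ?thesis using False by (simp add: abs_le_iff)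
qed

lemma scaleR_le_abs_lattice:
  fixes x :: "'a::banach_lattice"
  shows "a *\<^sub>R x \<le> \<bar>a\<bar> *\<^sub>R \<bar>x\<bar>"
  using abs_scaleR_lattice[of a x] abs_le_D1 by blast

lemma sup_zero_diff_le:
  fixes x y :: "'a::banach_lattice"
  shows "\<bar>sup x 0 - sup y 0\<bar> \<le> \<bar>x - y\<bar>"
proof -
  have *: "sup u 0 - sup v 0 \<le> \<bar>u - v\<bar>" for u v :: 'a
  proof -
    have "u \<le> sup v 0 + \<bar>u - v\<bar>"
      using add_mono[OF sup.cobounded1[of v 0] abs_ge_self[of "u - v"]] by simp
    moreover have "0 \<le> sup v 0 + \<bar>u - v\<bar>"
      by (simp add: add_nonneg_nonneg)
    ultimately show ?thesis by (simp only: diff_le_eq le_sup_iff add.commute)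
  qed
  have "- (sup x 0 - sup y 0) \<le> \<bar>x - y\<bar>"
    using *[of y x] by (simp only: minus_diff_eq abs_minus_commute)
  with *[of x y] show ?thesis by (rule abs_leI)
qed

lemma LIMSEQ_nonneg_lattice:
  fixes X :: "nat \<Rightarrow> 'a::banach_lattice"
  assumes "X \<longlonglongrightarrow> x" "\<And>n. 0 \<le> X n"
  shows "0 \<le> x"
proof -
  have "(\<lambda>n. norm (X n - x)) \<longlonglongrightarrow> 0"
    using assms(1) LIM_zero tendsto_norm_zero by blast
  then have "(\<lambda>n. norm (sup (X n) 0 - sup x 0)) \<longlonglongrightarrow> 0"
    by (rule Lim_null_comparison[rotated])
      (intro always_eventually allI, simp only: real_norm_def abs_norm_cancel norm_lattice_mono[OF sup_zero_diff_le])
  then have "(\<lambda>n. sup (X n) 0) \<longlonglongrightarrow> sup x 0"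
    by (rule LIM_zero_cancel[OF tendsto_norm_zero_cancel])
  moreover have "(\<lambda>n. sup (X n) 0) = X"
    using assms(2) by (simp add: sup.absorb1 fun_eq_iff)
  ultimately have "X \<longlonglongrightarrow> sup x 0" by simp
  with assms(1) have "x = sup x 0" by (rule LIMSEQ_unique)
  then show ?thesis by (metis sup.cobounded2)
qed

lemma LIMSEQ_le_lattice:
  fixes X Y :: "nat \<Rightarrow> 'a::banach_lattice"
  assumes "X \<longlonglongrightarrow> x" "Y \<longlonglongrightarrow> y" "\<And>n. X n \<le> Y n"
  shows "x \<le> y"
  using LIMSEQ_nonneg_lattice[OF tendsto_diff[OF assms(2,1)]] assms(3) by simp

section \<open>Complexification\<close>

text \<open>
  A complex Banach lattice is the complexification \<open>E = E\<^sub>\<real> + \<i> E\<^sub>\<real>\<close> of a real Banach lattice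
  \<open>E\<^sub>\<real>\<close>, with modulus \<open>\<bar>x + \<i> y\<bar> = sup\<^sub>\<theta> (cos \<theta> x + sin \<theta> y)\<close>, the supremum being taken
  in \<open>E\<^sub>\<real>\<close>, and norm \<open>\<parallel>z\<parallel> = \<parallel> \<bar>z\<bar> \<parallel>\<close>.
\<close>

datatype 'a complexification = Cplx (re_part: 'a) (im_part: 'a)

lemma complexification_eq_iff:
  "z = w \<longleftrightarrow> re_part z = re_part w \<and> im_part z = im_part w"
  by (rule complexification.expand[THEN iffI[rotated]]) auto

text \<open>The least upper bound exists by norm completeness; see \<open>cmodulus_exists\<close> below.\<close>

definition cmodulus :: "'a::banach_lattice complexification \<Rightarrow> 'a" where
  "cmodulus z = (LEAST m. \<forall>\<theta>::real. cos \<theta> *\<^sub>R re_part z + sin \<theta> *\<^sub>R im_part z \<le> m)"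

instantiation complexification :: (banach_lattice) "{ab_group_add, scaleR, norm, abs, ord}"
begin

definition zero_complexification :: "'a complexification" where
  "0 = Cplx 0 0"

definition plus_complexification ::
    "'a complexification \<Rightarrow> 'a complexification \<Rightarrow> 'a complexification" where
  "z + w = Cplx (re_part z + re_part w) (im_part z + im_part w)"

definition uminus_complexification :: "'a complexification \<Rightarrow> 'a complexification" where
  "- z = Cplx (- re_part z) (- im_part z)"

definition minus_complexification ::
    "'a complexification \<Rightarrow> 'a complexification \<Rightarrow> 'a complexification" where
  "z - w = Cplx (re_part z - re_part w) (im_part z - im_part w)"

definition scaleR_complexification :: "real \<Rightarrow> 'a complexification \<Rightarrow> 'a complexification" where
  "a *\<^sub>R z = Cplx (a *\<^sub>R re_part z) (a *\<^sub>R im_part z)"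

definition norm_complexification :: "'a complexification \<Rightarrow> real" where
  "norm z = norm (cmodulus z)"

text \<open>The modulus, regarded as an element of \<open>E\<close> via the embedding of \<open>E\<^sub>\<real>\<close>.\<close>

definition abs_complexification :: "'a complexification \<Rightarrow> 'a complexification" where
  "\<bar>z\<bar> = Cplx (cmodulus z) 0"

text \<open>\<open>z \<le> w\<close> means that \<open>w - z\<close> lies in the positive cone of \<open>E\<^sub>\<real>\<close>; in particular \<open>0 \<le> z\<close>
  forces \<open>z\<close> to be real.\<close>

definition less_eq_complexification ::
    "'a complexification \<Rightarrow> 'a complexification \<Rightarrow> bool" where
  "z \<le> w \<longleftrightarrow> re_part z \<le> re_part w \<and> im_part z = im_part w"

definition less_complexification ::
    "'a complexification \<Rightarrow> 'a complexification \<Rightarrow> bool" where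
  "z < w \<longleftrightarrow> z \<le> w \<and> \<not> w \<le> (z :: 'a complexification)"

instance
  by standard
    (simp_all add: complexification_eq_iff zero_complexification_def plus_complexification_def
      uminus_complexification_def minus_complexification_def algebra_simps)

end

lemma complexification_sel [simp]:
  fixes z w :: "'a::banach_lattice complexification"
  shows "re_part (0 :: 'a complexification) = 0" "im_part (0 :: 'a complexification) = 0"
    "re_part (z + w) = re_part z + re_part w" "im_part (z + w) = im_part z + im_part w"
    "re_part (- z) = - re_part z" "im_part (- z) = - im_part z"
    "re_part (z - w) = re_part z - re_part w" "im_part (z - w) = im_part z - im_part w"
    "re_part (a *\<^sub>R z) = a *\<^sub>R re_part z" "im_part (a *\<^sub>R z) = a *\<^sub>R im_part z"
  by (simp_all add: zero_complexification_def plus_complexification_def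
      uminus_complexification_def minus_complexification_def scaleR_complexification_def)

definition scaleC :: "complex \<Rightarrow> 'a::banach_lattice complexification \<Rightarrow> 'a complexification"
    (infixr \<open>*\<^sub>C\<close> 75) where
  "c *\<^sub>C z = Cplx (Re c *\<^sub>R re_part z - Im c *\<^sub>R im_part z)
                 (Re c *\<^sub>R im_part z + Im c *\<^sub>R re_part z)"

lemma scaleC_sel [simp]:
  "re_part (c *\<^sub>C z) = Re c *\<^sub>R re_part z - Im c *\<^sub>R im_part z"
  "im_part (c *\<^sub>C z) = Re c *\<^sub>R im_part z + Im c *\<^sub>R re_part z"
  by (simp_all add: scaleC_def)

lemma vector_space_scaleC: "vector_space scaleC"
  by standard (simp_all add: complexification_eq_iff algebra_simps)

lemma scaleC_of_real: "of_real a *\<^sub>C z = a *\<^sub>R z"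
  by (simp add: complexification_eq_iff)

subsection \<open>The modulus\<close>

lemma cmodulus_exists:
  fixes x y :: "'a::banach_lattice"
  shows "\<exists>s. (\<forall>\<theta>::real. cos \<theta> *\<^sub>R x + sin \<theta> *\<^sub>R y \<le> s) \<and>
             (\<forall>m. (\<forall>\<theta>::real. cos \<theta> *\<^sub>R x + sin \<theta> *\<^sub>R y \<le> m) \<longrightarrow> s \<le> m)"
proof -
  define f where "f w = Re w *\<^sub>R x + Im w *\<^sub>R y" for w
  define u where "u = \<bar>x\<bar> + \<bar>y\<bar>"
  have u0: "0 \<le> u" by (simp add: u_def add_nonneg_nonneg)
  have f_near: "f w \<le> f v + dist w v *\<^sub>R u" for w v
  proof -
    have "f w - f v = Re (w - v) *\<^sub>R x + Im (w - v) *\<^sub>R y"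
      by (simp add: f_def algebra_simps)
    also have "\<dots> \<le> \<bar>Re (w - v)\<bar> *\<^sub>R \<bar>x\<bar> + \<bar>Im (w - v)\<bar> *\<^sub>R \<bar>y\<bar>"
      by (intro add_mono scaleR_le_abs_lattice)
    also have "\<dots> \<le> dist w v *\<^sub>R \<bar>x\<bar> + dist w v *\<^sub>R \<bar>y\<bar>"
      by (intro add_mono scaleR_right_mono)
        (simp_all only: dist_norm abs_Re_le_cmod abs_Im_le_cmod abs_ge_zero)
    finally show ?thesis by (simp add: u_def algebra_simps)
  qed
  have "\<forall>n. \<exists>s. (\<forall>w\<in>sphere 0 1. f w \<le> s + inverse (real (Suc n)) *\<^sub>R u) \<and>
            (\<forall>m. (\<forall>w\<in>sphere 0 1. f w \<le> m) \<longrightarrow> s \<le> m)"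
  proof
    fix n
    obtain K where K: "finite K" "K \<subseteq> sphere (0::complex) 1"
        "sphere 0 1 \<subseteq> (\<Union>v\<in>K. ball v (inverse (real (Suc n))))"
      using seq_compact_imp_totally_bounded[of "sphere (0::complex) 1"]
      by (metis compact_eq_seq_compact_metric compact_sphere inverse_positive_iff_positive
          of_nat_0_less_iff zero_less_Suc)
    have "K \<noteq> {}"
      using subsetD[OF K(3), of 1] by auto
    define s where "s = Sup_fin (f ` K)"
    have "f w \<le> s + inverse (real (Suc n)) *\<^sub>R u" if w: "w \<in> sphere 0 1" for w
    proof -
      obtain v where v: "v \<in> K" "dist v w < inverse (real (Suc n))"
        using subsetD[OF K(3) w] by auto
      have "f w \<le> f v + dist w v *\<^sub>R u" by (rule f_near)
      also have "\<dots> \<le> s + inverse (real (Suc n)) *\<^sub>R u"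
        using v K(1) u0 unfolding s_def
        by (intro add_mono scaleR_right_mono Sup_fin.coboundedI) (auto simp: dist_commute)
      finally show ?thesis .
    qed
    moreover have "s \<le> m" if "\<forall>w\<in>sphere 0 1. f w \<le> m" for m
      unfolding s_def using K \<open>K \<noteq> {}\<close> that by (intro Sup_fin.boundedI) auto
    ultimately show "\<exists>s. (\<forall>w\<in>sphere 0 1. f w \<le> s + inverse (real (Suc n)) *\<^sub>R u) \<and>
            (\<forall>m. (\<forall>w\<in>sphere 0 1. f w \<le> m) \<longrightarrow> s \<le> m)" by blast
  qed
  from choice[OF this] obtain s where
    s1: "\<And>n w. w \<in> sphere 0 1 \<Longrightarrow> f w \<le> s n + inverse (real (Suc n)) *\<^sub>R u" and
    s2: "\<And>n m. (\<And>w. w \<in> sphere 0 1 \<Longrightarrow> f w \<le> m) \<Longrightarrow> s n \<le> m"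
    by blast
  have s_le: "s m \<le> s n + inverse (real (Suc n)) *\<^sub>R u" for m n
    by (intro s2 s1)
  have dist_s: "dist (s m) (s n) \<le> (inverse (real (Suc m)) + inverse (real (Suc n))) * norm u" for m n
  proof -
    define d where "d = inverse (real (Suc m)) + inverse (real (Suc n))"
    have d: "0 \<le> d" by (simp add: d_def)
    have "inverse (real (Suc n)) *\<^sub>R u \<le> d *\<^sub>R u" "inverse (real (Suc m)) *\<^sub>R u \<le> d *\<^sub>R u"
      by (intro scaleR_right_mono u0; simp add: d_def)+
    then have "s m - s n \<le> d *\<^sub>R u" "s n - s m \<le> d *\<^sub>R u"
      using s_le[of m n] s_le[of n m] by (metis add.commute diff_le_eq order_trans)+
    then have "\<bar>s m - s n\<bar> \<le> d *\<^sub>R u" by (intro abs_leI) simp_all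
    then have "\<bar>s m - s n\<bar> \<le> \<bar>d *\<^sub>R u\<bar>" using abs_ge_self order_trans by blast
    then have "norm (s m - s n) \<le> norm (d *\<^sub>R u)" by (rule norm_lattice_mono)
    then show ?thesis using d by (simp add: dist_norm d_def)
  qed
  have inv0: "(\<lambda>n. inverse (real (Suc n))) \<longlonglongrightarrow> 0"
    by (rule LIMSEQ_inverse_real_of_nat)
  have "Cauchy s"
  proof (rule metric_CauchyI)
    fix e :: real assume "0 < e"
    have "(\<lambda>n. inverse (real (Suc n)) * norm u) \<longlonglongrightarrow> 0"
      using tendsto_mult_left_zero[OF inv0] .
    then have "\<forall>\<^sub>F n in sequentially. inverse (real (Suc n)) * norm u < e / 2"
      using \<open>0 < e\<close> by (intro order_tendstoD(2)) auto
    then obtain N where N: "\<And>n. n \<ge> N \<Longrightarrow> inverse (real (Suc n)) * norm u < e / 2"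
      unfolding eventually_sequentially by blast
    have "dist (s m) (s n) < e" if "m \<ge> N" "n \<ge> N" for m n
      using dist_s[of m n] N[OF that(1)] N[OF that(2)] by (simp only: distrib_right)
    then show "\<exists>M. \<forall>m\<ge>M. \<forall>n\<ge>M. dist (s m) (s n) < e" by blast
  qed
  then obtain l where l: "s \<longlonglongrightarrow> l" using Cauchy_convergent convergent_def by blast
  have "(\<lambda>n. s n + inverse (real (Suc n)) *\<^sub>R u) \<longlonglongrightarrow> l + 0 *\<^sub>R u"
    by (intro tendsto_intros l inv0)
  then have up: "f w \<le> l" if "w \<in> sphere 0 1" for w
    using LIMSEQ_le_lattice[OF tendsto_const _ s1[OF that]] by simp
  have least: "l \<le> m" if "\<And>w. w \<in> sphere 0 1 \<Longrightarrow> f w \<le> m" for m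
    using LIMSEQ_le_lattice[OF l tendsto_const s2[OF that]] .
  have cis: "f (cis \<theta>) = cos \<theta> *\<^sub>R x + sin \<theta> *\<^sub>R y" for \<theta>
    by (simp add: f_def)
  have "l \<le> m" if "\<forall>\<theta>::real. cos \<theta> *\<^sub>R x + sin \<theta> *\<^sub>R y \<le> m" for m
  proof (rule least)
    fix w :: complex assume "w \<in> sphere 0 1"
    then have "w = cis (Arg w)" using rcis_cmod_Arg[of w] by (simp add: rcis_def)
    then show "f w \<le> m" using that cis by metis
  qed
  moreover have "cos \<theta> *\<^sub>R x + sin \<theta> *\<^sub>R y \<le> l" for \<theta>
    using up[of "cis \<theta>"] by (simp add: cis)
  ultimately show ?thesis by blast
qed

lemma cmodulus_lub:
  shows cmodulus_upper: "cos \<theta> *\<^sub>R re_part z + sin \<theta> *\<^sub>R im_part z \<le> cmodulus z"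
    and cmodulus_least:
      "(\<And>\<theta>. cos \<theta> *\<^sub>R re_part z + sin \<theta> *\<^sub>R im_part z \<le> m) \<Longrightarrow> cmodulus z \<le> m"
proof -
  obtain s where s: "\<forall>\<theta>::real. cos \<theta> *\<^sub>R re_part z + sin \<theta> *\<^sub>R im_part z \<le> s"
      "\<And>m. \<forall>\<theta>::real. cos \<theta> *\<^sub>R re_part z + sin \<theta> *\<^sub>R im_part z \<le> m \<Longrightarrow> s \<le> m"
    using cmodulus_exists[of "re_part z" "im_part z"] by blast
  have "cmodulus z = s"
    unfolding cmodulus_def using s by (intro Least_equality) auto
  with s show "cos \<theta> *\<^sub>R re_part z + sin \<theta> *\<^sub>R im_part z \<le> cmodulus z"
    "(\<And>\<theta>. cos \<theta> *\<^sub>R re_part z + sin \<theta> *\<^sub>R im_part z \<le> m) \<Longrightarrow> cmodulus z \<le> m"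
    by auto
qed

lemma cmodulus_ge_re: "\<bar>re_part z\<bar> \<le> cmodulus z"
  using cmodulus_upper[of 0 z] cmodulus_upper[of pi z] by (simp add: abs_le_iff)

lemma cmodulus_ge_im: "\<bar>im_part z\<bar> \<le> cmodulus z"
  using cmodulus_upper[of "pi/2" z] cmodulus_upper[of "- pi/2" z] by (simp add: abs_le_iff)

lemma cmodulus_nonneg: "0 \<le> cmodulus z"
  using cmodulus_ge_re[of z] abs_ge_zero order_trans by blast

lemma cmodulus_le: "cmodulus z \<le> \<bar>re_part z\<bar> + \<bar>im_part z\<bar>"
proof (rule cmodulus_least)
  fix \<theta> :: real
  have "cos \<theta> *\<^sub>R re_part z + sin \<theta> *\<^sub>R im_part z
      \<le> \<bar>cos \<theta>\<bar> *\<^sub>R \<bar>re_part z\<bar> + \<bar>sin \<theta>\<bar> *\<^sub>R \<bar>im_part z\<bar>"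
    by (intro add_mono scaleR_le_abs_lattice)
  also have "\<dots> \<le> 1 *\<^sub>R \<bar>re_part z\<bar> + 1 *\<^sub>R \<bar>im_part z\<bar>"
    by (intro add_mono scaleR_right_mono) simp_all
  finally show "cos \<theta> *\<^sub>R re_part z + sin \<theta> *\<^sub>R im_part z \<le> \<bar>re_part z\<bar> + \<bar>im_part z\<bar>"
    by simp
qed

lemma cmodulus_upper_complex: "Re w *\<^sub>R re_part z + Im w *\<^sub>R im_part z \<le> cmod w *\<^sub>R cmodulus z"
proof -
  have "Re w = cmod w * cos (Arg w)" "Im w = cmod w * sin (Arg w)"
    by (metis Re_rcis rcis_cmod_Arg, metis Im_rcis rcis_cmod_Arg)
  then have "Re w *\<^sub>R re_part z + Im w *\<^sub>R im_part z =
      cmod w *\<^sub>R (cos (Arg w) *\<^sub>R re_part z + sin (Arg w) *\<^sub>R im_part z)"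
    by (simp add: scaleR_add_right)
  also have "\<dots> \<le> cmod w *\<^sub>R cmodulus z"
    by (intro scaleR_left_mono cmodulus_upper) simp
  finally show ?thesis .
qed

lemma cmodulus_triangle: "cmodulus (z + w) \<le> cmodulus z + cmodulus w"
proof (rule cmodulus_least)
  fix \<theta> :: real
  show "cos \<theta> *\<^sub>R re_part (z + w) + sin \<theta> *\<^sub>R im_part (z + w) \<le> cmodulus z + cmodulus w"
    using add_mono[OF cmodulus_upper[of \<theta> z] cmodulus_upper[of \<theta> w]]
    by (simp add: algebra_simps)
qed

lemma cmodulus_scaleC: "cmodulus (c *\<^sub>C z) = cmod c *\<^sub>R cmodulus z"
proof -
  have le: "cmodulus (c *\<^sub>C z) \<le> cmod c *\<^sub>R cmodulus z" for c z
  proof (rule cmodulus_least)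
    fix \<theta> :: real
    show "cos \<theta> *\<^sub>R re_part (c *\<^sub>C z) + sin \<theta> *\<^sub>R im_part (c *\<^sub>C z) \<le> cmod c *\<^sub>R cmodulus z"
      using cmodulus_upper_complex[of "cnj c * cis \<theta>" z]
      by (simp add: norm_mult algebra_simps)
  qed
  show ?thesis
  proof (cases "c = 0")
    case True
    then show ?thesis using le[of c z] cmodulus_nonneg[of "c *\<^sub>C z"] by simp
  next
    case False
    interpret vector_space scaleC by (rule vector_space_scaleC)
    have "cmod c *\<^sub>R cmodulus z = cmod c *\<^sub>R cmodulus (inverse c *\<^sub>C c *\<^sub>C z)"
      using False by simp
    also have "\<dots> \<le> cmod c *\<^sub>R cmod (inverse c) *\<^sub>R cmodulus (c *\<^sub>C z)"
      by (intro scaleR_left_mono le) simp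
    also have "\<dots> = cmodulus (c *\<^sub>C z)"
      using False by (simp add: norm_inverse)
    finally show ?thesis using le[of c z] by simp
  qed
qed

lemma cmodulus_eq_0_iff: "cmodulus z = 0 \<longleftrightarrow> z = 0"
proof
  assume "cmodulus z = 0"
  then show "z = 0"
    using cmodulus_ge_re[of z] cmodulus_ge_im[of z] by (simp add: complexification_eq_iff)
next
  assume "z = 0"
  then show "cmodulus z = 0"
    using cmodulus_le[of z] cmodulus_nonneg[of z] by simp
qed

lemma cmodulus_of_real_part: "cmodulus (Cplx x 0) = \<bar>x\<bar>"
  using cmodulus_le[of "Cplx x 0"] cmodulus_ge_re[of "Cplx x 0"] by simp

subsection \<open>Norm and order\<close>

instantiation complexification :: (banach_lattice) real_normed_vector
begin

definition dist_complexification :: "'a complexification \<Rightarrow> 'a complexification \<Rightarrow> real" where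
  "dist_complexification z w = norm (z - w)"

definition sgn_complexification :: "'a complexification \<Rightarrow> 'a complexification" where
  "sgn_complexification z = z /\<^sub>R norm z"

definition uniformity_complexification :: "('a complexification \<times> 'a complexification) filter" where
  "uniformity_complexification = (INF e\<in>{0<..}. principal {(z, w). dist z w < e})"

definition open_complexification :: "'a complexification set \<Rightarrow> bool" where
  "open_complexification U \<longleftrightarrow> (\<forall>z\<in>U. \<forall>\<^sub>F (z', w) in uniformity. z' = z \<longrightarrow> w \<in> U)"

instance
proof
  fix z w :: "'a complexification" and a :: real
  show "norm (z + w) \<le> norm z + norm w"
  proof -
    have "norm (cmodulus (z + w)) \<le> norm (cmodulus z + cmodulus w)"
      by (intro norm_mono_nonneg cmodulus_nonneg cmodulus_triangle)
    then show ?thesis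
      unfolding norm_complexification_def using norm_triangle_ineq order_trans by blast
  qed
  show "norm (a *\<^sub>R z) = \<bar>a\<bar> * norm z"
    using cmodulus_scaleC[of "of_real a" z]
    by (simp add: norm_complexification_def scaleC_of_real)
qed (simp_all add: dist_complexification_def sgn_complexification_def
    uniformity_complexification_def open_complexification_def norm_complexification_def
    cmodulus_eq_0_iff complexification_eq_iff algebra_simps)

end

lemma norm_scaleC: "norm (c *\<^sub>C z) = cmod c * norm z"
  by (simp add: norm_complexification_def cmodulus_scaleC)

lemma norm_abs_complexification: "norm \<bar>z\<bar> = norm (z :: 'a::banach_lattice complexification)"
  by (simp add: norm_complexification_def abs_complexification_def cmodulus_of_real_part norm_abs)

lemma norm_re_part_le: "norm (re_part z) \<le> norm z"
  and norm_im_part_le: "norm (im_part z) \<le> norm z"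
  unfolding norm_complexification_def
  by (metis norm_abs norm_mono_nonneg abs_ge_zero cmodulus_ge_re,
      metis norm_abs norm_mono_nonneg abs_ge_zero cmodulus_ge_im)

lemma norm_complexification_le: "norm z \<le> norm (re_part z) + norm (im_part z)"
  unfolding norm_complexification_def
  using norm_mono_nonneg[OF cmodulus_nonneg cmodulus_le, of z]
    norm_triangle_ineq[of "\<bar>re_part z\<bar>" "\<bar>im_part z\<bar>"] by (simp add: norm_abs)

instance complexification :: (banach_lattice) banach
proof
  fix X :: "nat \<Rightarrow> 'a complexification" assume X: "Cauchy X"
  have "bounded_linear (re_part :: 'a complexification \<Rightarrow> 'a)"
       "bounded_linear (im_part :: 'a complexification \<Rightarrow> 'a)"
    by (auto intro!: bounded_linear_intro[of _ 1] simp: norm_re_part_le norm_im_part_le)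
  then have "Cauchy (\<lambda>n. re_part (X n))" "Cauchy (\<lambda>n. im_part (X n))"
    using X by (auto intro: bounded_linear.Cauchy)
  then obtain x y where x: "(\<lambda>n. re_part (X n)) \<longlonglongrightarrow> x" and y: "(\<lambda>n. im_part (X n)) \<longlonglongrightarrow> y"
    using Cauchy_convergent unfolding convergent_def by blast
  have "(\<lambda>n. norm (re_part (X n) - x) + norm (im_part (X n) - y)) \<longlonglongrightarrow> 0 + 0"
    using x y by (intro tendsto_add; simp add: LIM_zero tendsto_norm_zero)
  moreover have "norm (X n - Cplx x y) \<le> norm (re_part (X n) - x) + norm (im_part (X n) - y)" for n
    using norm_complexification_le[of "X n - Cplx x y"] by simp
  ultimately have "(\<lambda>n. X n - Cplx x y) \<longlonglongrightarrow> 0"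
    by (metis (no_types, lifting) Lim_null_comparison add.right_neutral always_eventually)
  then have "X \<longlonglongrightarrow> Cplx x y" by (rule LIM_zero_cancel)
  then show "convergent X" by (rule convergentI)
qed

instance complexification :: (banach_lattice) ordered_real_vector
  by standard
    (auto simp: less_eq_complexification_def less_complexification_def complexification_eq_iff
      intro: scaleR_left_mono scaleR_right_mono)

section \<open>Operators and spectrum\<close>

definition bounded_clinear ::
    "('a::banach_lattice complexification \<Rightarrow> 'a complexification) \<Rightarrow> bool" where
  "bounded_clinear T \<longleftrightarrow> bounded_linear T \<and> (\<forall>c x. T (c *\<^sub>C x) = c *\<^sub>C T x)"

definition positive_operator ::
    "('a::banach_lattice complexification \<Rightarrow> 'a complexification) \<Rightarrow> bool" where
  "positive_operator T \<longleftrightarrow> (\<forall>x\<ge>0. T x \<ge> 0)"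

definition spectrum ::
    "('a::banach_lattice complexification \<Rightarrow> 'a complexification) \<Rightarrow> complex set" where
  "spectrum T = {\<mu>. \<not> (\<exists>S. bounded_clinear S \<and>
     (\<forall>x. S (\<mu> *\<^sub>C x - T x) = x) \<and> (\<forall>x. \<mu> *\<^sub>C S x - T (S x) = x))}"

definition spectral_radius ::
    "('a::banach_lattice complexification \<Rightarrow> 'a complexification) \<Rightarrow> real" where
  "spectral_radius T = (SUP \<mu>\<in>spectrum T. cmod \<mu>)"

definition peripheral_spectrum ::
    "('a::banach_lattice complexification \<Rightarrow> 'a complexification) \<Rightarrow> complex set" where
  "peripheral_spectrum T = {\<mu> \<in> spectrum T. cmod \<mu> = spectral_radius T}"

definition resolvent ::
    "complex \<Rightarrow> ('a::banach_lattice complexification \<Rightarrow> 'a complexification) \<Rightarrow>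
     'a complexification \<Rightarrow> 'a complexification" where
  "resolvent \<mu> T = inv (\<lambda>x. \<mu> *\<^sub>C x - T x)"

lemma resolvent_inverse:
  assumes "\<mu> \<notin> spectrum T"
  shows "bounded_clinear (resolvent \<mu> T)"
    and "resolvent \<mu> T (\<mu> *\<^sub>C x - T x) = x"
    and "\<mu> *\<^sub>C resolvent \<mu> T x - T (resolvent \<mu> T x) = x"
proof -
  obtain S where S: "bounded_clinear S" "\<And>x. S (\<mu> *\<^sub>C x - T x) = x"
      "\<And>x. \<mu> *\<^sub>C S x - T (S x) = x"
    using assms by (auto simp: spectrum_def)
  have "resolvent \<mu> T = S"
    unfolding resolvent_def using S(2,3) by (intro inv_unique_comp) (auto simp: fun_eq_iff)
  with S show "bounded_clinear (resolvent \<mu> T)"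
    and "resolvent \<mu> T (\<mu> *\<^sub>C x - T x) = x"
    and "\<mu> *\<^sub>C resolvent \<mu> T x - T (resolvent \<mu> T x) = x"
    by simp_all
qed

text \<open>Mutual \<open>O\<close>, which is weaker than asymptotic equivalence \<open>a \<sim>[sequentially] b\<close>.\<close>

definition same_growth :: "(nat \<Rightarrow> real) \<Rightarrow> (nat \<Rightarrow> real) \<Rightarrow> bool" where
  "same_growth a b \<longleftrightarrow> a \<in> O(b) \<and> b \<in> O(a)"

end

theory Submission
  imports Defs
begin

text \<open>
  Let \<open>\<omega> = \<mu>\<^sup>k\<close> and \<open>R(r) = (r - T)\<inverse>\<close>. The inequality \<open>\<bar>z\<bar> = \<bar>T z\<bar> \<le> T \<bar>z\<bar>\<close> and the positivity of
  \<open>R(r)\<close> give \<open>\<bar>z\<bar> \<le> (r - 1) R(r) \<bar>z\<bar>\<close>, which is the first claim. For the other two claims suppose that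
  \<open>\<omega>\<close> is not in the spectrum.

  If \<open>T \<bar>z\<bar> = \<bar>z\<bar>\<close>, then the power \<open>v = z\<^sup>[\<^sup>k\<^sup>] = \<bar>z\<bar> (z / \<bar>z\<bar>)\<^sup>k\<close> would satisfy \<open>T v = \<omega> v\<close>. In general
  \<open>v\<close> is an eigenvector up to the defect of \<open>\<bar>z\<bar>\<close>: there is a constant \<open>M\<close>, depending only on \<open>k\<close>, with
  \<open>\<bar>T v - \<omega> v\<bar> \<le> M (T \<bar>z\<bar> - \<bar>z\<bar>)\<close> (lemma \<open>lattice_power_almost_eigenvector\<close>). Behind this is the scalar
  fact that \<open>w \<mapsto> \<bar>w\<bar> (w / \<bar>w\<bar>)\<^sup>k\<close> differs from its real linearisation at a point \<open>e\<^sup>i\<^sup>\<phi>\<close> of the unit circle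
  by at most \<open>M (\<bar>w\<bar> - Re (e\<^sup>-\<^sup>i\<^sup>\<phi> w))\<close>. Positive operators preserve such an estimate, and
  the infimum over \<open>\<phi>\<close> of \<open>\<bar>z\<bar> - Re (e\<^sup>-\<^sup>i\<^sup>\<phi> z)\<close> is \<open>0\<close> by the definition of the modulus; this replaces a
  representation of principal ideals as spaces of continuous functions. The same estimate serves as
  the definition of \<open>v\<close>.

  Put \<open>w = T v - \<omega> v\<close>. Then \<open>v = (r - 1) \<omega> R(r\<omega>) v - R(r\<omega>) w\<close>, the operators \<open>R(r\<omega>)\<close> stay bounded as
  \<open>r\<close> decreases to \<open>1\<close>, and \<open>\<bar>R(r\<omega>) w\<bar> \<le> R(r) \<bar>w\<bar> \<le> M R(r) (T \<bar>z\<bar> - \<bar>z\<bar>) = M ((r - 1) R(r) \<bar>z\<bar> - \<bar>z\<bar>)\<close>.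
  Since \<open>\<bar>z\<bar> \<le> \<bar>v\<bar>\<close>, this gives
  \<open>(1 + M) \<bar>z\<bar> \<le> M (r - 1) R(r) \<bar>z\<bar> + e(r)\<close> with \<open>\<parallel>e(r)\<parallel> = O(r - 1)\<close>
  (lemma \<open>regular_power_inequality\<close>). Apply \<open>R(s)\<close>, and use \<open>\<bar>s - r\<bar> R(s) R(r) \<bar>z\<bar> \<le> R(min r s) \<bar>z\<bar>\<close>, which follows
  from the resolvent identity.

  If \<open>\<parallel>R(r\<^sub>n) \<bar>z\<bar>\<parallel>\<close> grows like \<open>1 / (r\<^sub>n - 1)\<close>, keep \<open>s = r\<^sub>m\<close> and let \<open>r = r\<^sub>n\<close> tend to \<open>1\<close>: every upper bound
  \<open>L\<close> of the numbers \<open>(r\<^sub>n - 1) \<parallel>R(r\<^sub>n) \<bar>z\<bar>\<parallel>\<close> can be improved to \<open>L M / (1 + M)\<close>, although all these numbers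
  are at least \<open>1\<close>. If \<open>\<parallel>R(r\<^sub>n) \<bar>z\<bar>\<parallel>\<close> grows like \<open>\<parallel>R(r\<^sub>n)\<parallel>\<close>, exchange the roles of the two parameters: with \<open>r\<close>
  fixed and \<open>s = r\<^sub>n\<close>, division by \<open>\<parallel>R(r\<^sub>n) \<bar>z\<bar>\<parallel>\<close> and the limit in \<open>n\<close> give \<open>1 + M \<le> M + O(r - 1)\<close>, which
  fails when \<open>r\<close> is close to \<open>1\<close>.
\<close>

section \<open>Order and modulus in the complexification\<close>

lemma abs_complexification_nonneg: "0 \<le> \<bar>z\<bar>" for z :: "'a::banach_lattice complexification"
  by (simp add: less_eq_complexification_def abs_complexification_def cmodulus_nonneg)

lemma abs_complexification_triangle: "\<bar>z + w\<bar> \<le> \<bar>z\<bar> + \<bar>w\<bar>"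
  for z :: "'a::banach_lattice complexification"
  by (simp add: less_eq_complexification_def abs_complexification_def cmodulus_triangle)

lemma abs_scaleC: "\<bar>c *\<^sub>C z\<bar> = cmod c *\<^sub>R \<bar>z\<bar>"
  by (simp add: abs_complexification_def cmodulus_scaleC complexification_eq_iff)

lemma abs_minus_complexification: "\<bar>- z\<bar> = \<bar>z\<bar>" for z :: "'a::banach_lattice complexification"
proof -
  have "- z = (-1) *\<^sub>C z" by (simp add: complexification_eq_iff)
  then show ?thesis by (simp add: abs_scaleC)
qed

lemma abs_of_nonneg_complexification:
  "0 \<le> z \<Longrightarrow> \<bar>z\<bar> = z" for z :: "'a::banach_lattice complexification"
  by (cases z) (auto simp: less_eq_complexification_def abs_complexification_def
      cmodulus_of_real_part)

lemma abs_complexification_idem [simp]: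
  "\<bar>\<bar>z\<bar>\<bar> = \<bar>z\<bar>" for z :: "'a::banach_lattice complexification"
  by (simp add: abs_of_nonneg_complexification abs_complexification_nonneg)

lemma norm_le_of_abs_le:
  fixes x y :: "'a::banach_lattice complexification"
  assumes "\<bar>x\<bar> \<le> y"
  shows "norm x \<le> norm y"
proof -
  have y: "cmodulus x \<le> re_part y"
    using assms by (auto simp: less_eq_complexification_def abs_complexification_def)
  also have "\<dots> \<le> cmodulus y"
    using cmodulus_ge_re[of y] abs_ge_self order_trans by blast
  finally show ?thesis
    unfolding norm_complexification_def by (intro norm_mono_nonneg cmodulus_nonneg)
qed

lemma norm_le_of_nonneg_le:
  fixes x y :: "'a::banach_lattice complexification"
  assumes "0 \<le> x" "x \<le> y"
  shows "norm x \<le> norm y"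
  using assms norm_le_of_abs_le[of x y] by (simp add: abs_of_nonneg_complexification)

lemma bounded_linear_re_part: "bounded_linear (re_part :: 'a::banach_lattice complexification \<Rightarrow> 'a)"
  and bounded_linear_im_part: "bounded_linear (im_part :: 'a complexification \<Rightarrow> 'a)"
  by (auto intro!: bounded_linear_intro[of _ 1] simp: norm_re_part_le norm_im_part_le)

lemma LIMSEQ_nonneg_complexification:
  fixes X :: "nat \<Rightarrow> 'a::banach_lattice complexification"
  assumes "X \<longlonglongrightarrow> x" "\<And>n. 0 \<le> X n"
  shows "0 \<le> x"
proof -
  have "(\<lambda>n. re_part (X n)) \<longlonglongrightarrow> re_part x" "(\<lambda>n. im_part (X n)) \<longlonglongrightarrow> im_part x"
    using assms(1) bounded_linear.tendsto[OF bounded_linear_re_part]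
      bounded_linear.tendsto[OF bounded_linear_im_part] by blast+
  moreover have "0 \<le> re_part (X n)" "im_part (X n) = 0" for n
    using assms(2)[of n] by (simp_all add: less_eq_complexification_def)
  ultimately have "0 \<le> re_part x" "im_part x = 0"
    by (auto intro: LIMSEQ_nonneg_lattice[of "\<lambda>n. re_part (X n)"] LIMSEQ_unique[OF _ tendsto_const])
  then show ?thesis by (simp add: less_eq_complexification_def)
qed

text \<open>
  \<open>dir_part w z\<close> is the real part of \<open>cnj w \<cdot> z\<close>, regarded as an element of the complexification; for \<open>w = cis \<phi>\<close>
  these are the elements whose supremum over \<open>\<phi>\<close> is the modulus of \<open>z\<close>.
\<close>

definition dir_part :: "complex \<Rightarrow> 'a::banach_lattice complexification \<Rightarrow> 'a complexification" where
  "dir_part w z = Cplx (Re w *\<^sub>R re_part z + Im w *\<^sub>R im_part z) 0"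

lemma dir_part_sel [simp]:
  "re_part (dir_part w z) = Re w *\<^sub>R re_part z + Im w *\<^sub>R im_part z"
  "im_part (dir_part w z) = 0"
  by (simp_all add: dir_part_def)

lemma dir_part_le: "dir_part w z \<le> cmod w *\<^sub>R \<bar>z\<bar>"
  using cmodulus_upper_complex[of w z]
  by (simp add: less_eq_complexification_def abs_complexification_def)

lemma abs_le_of_dir_part_le:
  assumes "\<And>\<phi>. dir_part (cis \<phi>) z \<le> m"
  shows "\<bar>z\<bar> \<le> m"
  using assms cmodulus_least[of z "re_part m"]
  by (simp add: less_eq_complexification_def abs_complexification_def)

text \<open>
  This is how an estimate is localised. If \<open>z\<close> is pictured as a function, its argument varies from point to point,
  so a bound is proved for each possible argument \<open>\<phi>\<close>, up to an error
  \<open>M (\<bar>z\<bar> - dir_part (cis \<phi>) z)\<close> that vanishes where the argument is \<open>\<phi>\<close>. Taking the infimum over \<open>\<phi>\<close> removes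
  the error.
\<close>

lemma scaleR_abs_le_of_dir_part_le:
  assumes M: "0 < M" and le: "\<And>\<phi>. M *\<^sub>R dir_part (cis \<phi>) z \<le> m"
  shows "M *\<^sub>R \<bar>z\<bar> \<le> m"
proof -
  have "dir_part (cis \<phi>) z \<le> inverse M *\<^sub>R m" for \<phi>
    using scaleR_left_mono[OF le[of \<phi>], of "inverse M"] M by simp
  then have "\<bar>z\<bar> \<le> inverse M *\<^sub>R m" by (rule abs_le_of_dir_part_le)
  then show ?thesis using scaleR_left_mono[of "\<bar>z\<bar>" "inverse M *\<^sub>R m" M] M by simp
qed

section \<open>Positive operators\<close>

lemma bounded_clinear_linear: "bounded_clinear T \<Longrightarrow> linear T"
  by (simp add: bounded_clinear_def bounded_linear.linear)

lemma bounded_clinear_scaleC: "bounded_clinear T \<Longrightarrow> T (c *\<^sub>C x) = c *\<^sub>C T x"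
  by (simp add: bounded_clinear_def)

lemma positive_operator_mono:
  assumes "bounded_clinear T" "positive_operator T" "x \<le> y"
  shows "T x \<le> T y"
proof -
  have "0 \<le> T (y - x)" using assms by (simp add: positive_operator_def)
  then show ?thesis by (simp add: linear_diff[OF bounded_clinear_linear[OF assms(1)]])
qed

text \<open>
  Every element of the real lattice is a difference of two positive ones.
\<close>

lemma positive_operator_real:
  assumes T: "bounded_clinear T" "positive_operator T"
  shows "im_part (T (Cplx x 0)) = 0"
proof -
  have *: "im_part (T (Cplx u 0)) = 0" if "0 \<le> u" for u
    using T(2) that by (auto simp: positive_operator_def less_eq_complexification_def)
  have "Cplx x 0 = Cplx (pprt x) 0 - Cplx (- nprt x) 0"
    by (simp add: complexification_eq_iff prts[symmetric])
  then have "T (Cplx x 0) = T (Cplx (pprt x) 0) - T (Cplx (- nprt x) 0)"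
    using linear_diff[OF bounded_clinear_linear[OF T(1)]] by metis
  then show ?thesis using *[of "pprt x"] *[of "- nprt x"] by simp
qed

lemma positive_operator_dir_part:
  assumes T: "bounded_clinear T" "positive_operator T"
  shows "T (dir_part w z) = dir_part w (T z)"
proof -
  note lin = bounded_clinear_linear[OF T(1)]
  define x where "x = Cplx (re_part z) 0"
  define y where "y = Cplx (im_part z) 0"
  have im: "im_part (T x) = 0" "im_part (T y) = 0"
    unfolding x_def y_def by (simp_all add: positive_operator_real[OF T])
  have "z = x + \<i> *\<^sub>C y" by (simp add: complexification_eq_iff x_def y_def)
  then have Tz: "T z = T x + \<i> *\<^sub>C T y"
    using linear_add[OF lin] bounded_clinear_scaleC[OF T(1)] by metis
  have "dir_part w z = Re w *\<^sub>R x + Im w *\<^sub>R y"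
    by (simp add: complexification_eq_iff x_def y_def)
  then have "T (dir_part w z) = Re w *\<^sub>R T x + Im w *\<^sub>R T y"
    by (simp add: linear_add[OF lin] linear_cmul[OF lin])
  then show ?thesis
    by (simp add: complexification_eq_iff Tz im)
qed

lemma positive_operator_abs_le:
  assumes T: "bounded_clinear T" "positive_operator T"
  shows "\<bar>T z\<bar> \<le> T \<bar>z\<bar>"
proof (rule abs_le_of_dir_part_le)
  fix \<phi>
  show "dir_part (cis \<phi>) (T z) \<le> T \<bar>z\<bar>"
    unfolding positive_operator_dir_part[OF T, symmetric]
    using positive_operator_mono[OF T dir_part_le[of "cis \<phi>" z]] by simp
qed

section \<open>Spectrum and resolvents\<close>

text \<open>
  The equation \<open>\<mu> x - T x = y\<close> is the fixed point equation of \<open>x \<mapsto> (y + T x) / \<mu>\<close>, which is a contraction.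
\<close>

lemma spectrum_bounded:
  assumes T: "bounded_clinear T" and "onorm T < cmod \<mu>"
  shows "\<mu> \<notin> spectrum T"
proof -
  interpret vector_space scaleC by (rule vector_space_scaleC)
  have bl: "bounded_linear T" using T by (simp add: bounded_clinear_def)
  note lin = bounded_linear.linear[OF bl]
  define q where "q = onorm T / cmod \<mu>"
  have mu: "0 < cmod \<mu>" "\<mu> \<noteq> 0" using assms(2) onorm_pos_le[OF bl] by auto
  have q: "0 \<le> q" "q < 1" using assms(2) mu onorm_pos_le[OF bl] by (auto simp: q_def)
  have diffC: "c *\<^sub>C x - c *\<^sub>C y = c *\<^sub>C (x - y)" for c and x y :: "'a complexification"
    by (simp add: scale_right_diff_distrib)
  have uniq: "\<exists>!x. inverse \<mu> *\<^sub>C (y + T x) = x" for y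
  proof (rule banach_fix_type[OF q], intro allI)
    fix x x'
    have "norm (inverse \<mu> *\<^sub>C (y + T x) - inverse \<mu> *\<^sub>C (y + T x')) = norm (T (x - x')) / cmod \<mu>"
      by (simp add: diffC linear_diff[OF lin, symmetric] norm_scaleC norm_inverse divide_inverse
          mult.commute)
    also have "\<dots> \<le> q * norm (x - x')"
      using divide_right_mono[OF onorm[OF bl, of "x - x'"], of "cmod \<mu>"] by (simp add: q_def)
    finally have "norm (inverse \<mu> *\<^sub>C (y + T x) - inverse \<mu> *\<^sub>C (y + T x')) \<le> q * norm (x - x')" .
    then show "dist (inverse \<mu> *\<^sub>C (y + T x)) (inverse \<mu> *\<^sub>C (y + T x')) \<le> q * dist x x'"
      by (simp add: dist_norm)
  qed
  have iff: "inverse \<mu> *\<^sub>C (y + T x) = x \<longleftrightarrow> \<mu> *\<^sub>C x - T x = y" for x y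
  proof -
    have "inverse \<mu> *\<^sub>C (y + T x) = x \<longleftrightarrow> y + T x = \<mu> *\<^sub>C x"
      using mu by (metis scale_scale scale_one left_inverse right_inverse)
    then show ?thesis by (auto simp: algebra_simps)
  qed
  define S where "S y = (THE x. \<mu> *\<^sub>C x - T x = y)" for y
  have S: "\<mu> *\<^sub>C S y - T (S y) = y" for y
    unfolding S_def using theI'[OF uniq[of y, unfolded iff]] .
  have Seq: "S y = x" if "\<mu> *\<^sub>C x - T x = y" for x y
    unfolding S_def using uniq[of y, unfolded iff] that by (rule the1_equality)
  have Sadd: "S (x + y) = S x + S y" for x y
    using S[of x] S[of y] by (intro Seq) (simp add: linear_add[OF lin] scale_right_distrib algebra_simps)
  have SC: "S (c *\<^sub>C x) = c *\<^sub>C S x" for c x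
  proof (rule Seq)
    have "\<mu> *\<^sub>C c *\<^sub>C S x - T (c *\<^sub>C S x) = c *\<^sub>C (\<mu> *\<^sub>C S x - T (S x))"
      by (simp add: bounded_clinear_scaleC[OF T] scale_right_diff_distrib mult.commute)
    then show "\<mu> *\<^sub>C c *\<^sub>C S x - T (c *\<^sub>C S x) = c *\<^sub>C x" by (simp add: S)
  qed
  have Sbound: "norm (S y) \<le> norm y * (1 / (cmod \<mu> - onorm T))" for y
  proof -
    have "cmod \<mu> * norm (S y) = norm (y + T (S y))"
      using S[of y] by (metis diff_add_cancel norm_scaleC)
    also have "\<dots> \<le> norm y + onorm T * norm (S y)"
      using norm_triangle_ineq[of y "T (S y)"] onorm[OF bl, of "S y"] by linarith
    finally show ?thesis using assms(2) by (simp add: field_simps)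
  qed
  have "bounded_linear S"
    using Sbound Sadd SC[of "complex_of_real _"]
    by (intro bounded_linear_intro[of S "1 / (cmod \<mu> - onorm T)"])
      (simp_all only: scaleC_of_real)
  then have "bounded_clinear S" by (simp add: bounded_clinear_def SC)
  then show ?thesis using S Seq by (auto simp: spectrum_def)
qed

text \<open>
  The spectral radius is a supremum of reals, so it bounds the spectrum only because the spectrum is bounded.
\<close>

lemma not_in_spectrum_of_radius_less:
  assumes T: "bounded_clinear T" and "spectral_radius T < cmod \<mu>"
  shows "\<mu> \<notin> spectrum T"
proof
  assume "\<mu> \<in> spectrum T"
  moreover have "bdd_above (cmod ` spectrum T)"
    using spectrum_bounded[OF T] by (intro bdd_aboveI2[where M = "onorm T"]) (meson not_le)
  ultimately have "cmod \<mu> \<le> spectral_radius T"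
    unfolding spectral_radius_def by (rule cSUP_upper)
  with assms(2) show False by simp
qed

lemma linear_scaleC_comp:
  assumes "bounded_clinear S" shows "linear (\<lambda>u. c *\<^sub>C S u)"
  by (rule linearI) (simp_all add: linear_add[OF bounded_clinear_linear[OF assms]]
      linear_cmul[OF bounded_clinear_linear[OF assms]] complexification_eq_iff algebra_simps)

lemma resolvent_linear:
  assumes "\<mu> \<notin> spectrum T"
  shows "bounded_linear (resolvent \<mu> T)" "linear (resolvent \<mu> T)"
  using resolvent_inverse(1)[OF assms] by (simp_all add: bounded_clinear_def bounded_linear.linear)

lemma resolvent_identity:
  assumes "\<mu> \<notin> spectrum T" "\<nu> \<notin> spectrum T"
  shows "resolvent \<nu> T x = resolvent \<mu> T x + (\<mu> - \<nu>) *\<^sub>C resolvent \<mu> T (resolvent \<nu> T x)"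
proof -
  interpret vector_space scaleC by (rule vector_space_scaleC)
  define y where "y = resolvent \<nu> T x"
  have "x = (\<mu> *\<^sub>C y - T y) - (\<mu> - \<nu>) *\<^sub>C y"
    using resolvent_inverse(3)[OF assms(2), of x] by (simp add: y_def algebra_simps)
  then have "resolvent \<mu> T x = resolvent \<mu> T (\<mu> *\<^sub>C y - T y) - resolvent \<mu> T ((\<mu> - \<nu>) *\<^sub>C y)"
    using linear_diff[OF resolvent_linear(2)[OF assms(1)]] by metis
  also have "\<dots> = y - (\<mu> - \<nu>) *\<^sub>C resolvent \<mu> T y"
    by (simp only: resolvent_inverse(2)[OF assms(1)]
        bounded_clinear_scaleC[OF resolvent_inverse(1)[OF assms(1)]])
  finally show ?thesis by (simp add: y_def)
qed

text \<open>
  The resolvent identity expresses the resolvent at \<open>\<nu>\<close> by the one at \<open>\<mu>\<close> plus a term whose norm is at most half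
  of that of the resolvent at \<open>\<nu>\<close> and can be absorbed.
\<close>

lemma onorm_resolvent_near:
  assumes \<mu>\<nu>: "\<mu> \<notin> spectrum T" "\<nu> \<notin> spectrum T"
    and near: "cmod (\<mu> - \<nu>) * onorm (resolvent \<mu> T) \<le> 1 / 2"
  shows "onorm (resolvent \<nu> T) \<le> 2 * onorm (resolvent \<mu> T)"
proof (rule onorm_bound)
  note bl = resolvent_linear(1)[OF \<mu>\<nu>(1)]
  show "0 \<le> 2 * onorm (resolvent \<mu> T)" using onorm_pos_le[OF bl] by simp
  fix x
  define y where "y = resolvent \<nu> T x"
  have "norm y \<le> norm (resolvent \<mu> T x) + cmod (\<mu> - \<nu>) * norm (resolvent \<mu> T y)"
    using resolvent_identity[OF \<mu>\<nu>, of x] norm_triangle_ineq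
    unfolding y_def by (metis norm_scaleC)
  also have "\<dots> \<le> onorm (resolvent \<mu> T) * norm x + cmod (\<mu> - \<nu>) * (onorm (resolvent \<mu> T) * norm y)"
    by (intro add_mono mult_left_mono onorm[OF bl]) simp
  also have "\<dots> \<le> onorm (resolvent \<mu> T) * norm x + 1 / 2 * norm y"
    using mult_right_mono[OF near, of "norm y"] by simp
  finally show "norm (resolvent \<nu> T x) \<le> 2 * onorm (resolvent \<mu> T) * norm x"
    by (simp add: y_def)
qed

section \<open>Domination of resolvents\<close>

lemma contraction_iterates:
  fixes A :: "'b::real_normed_vector \<Rightarrow> 'b"
  assumes "linear A" "\<And>x. norm (A x) \<le> q * norm x" "0 \<le> q" "q < 1" "y = a + A y"
  shows "(\<lambda>n. ((\<lambda>u. a + A u) ^^ n) 0) \<longlonglongrightarrow> y"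
proof -
  define X where "X n = ((\<lambda>u. a + A u) ^^ n) 0" for n
  have err: "norm (X n - y) \<le> q ^ n * norm y" for n
  proof (induction n)
    case (Suc n)
    have "X (Suc n) - y = A (X n - y)"
      using assms(5) by (simp add: X_def linear_diff[OF assms(1)] algebra_simps)
    then have "norm (X (Suc n) - y) \<le> q * norm (X n - y)" using assms(2) by simp
    also have "\<dots> \<le> q * (q ^ n * norm y)" using Suc assms(3) by (rule mult_left_mono)
    finally show ?case by simp
  qed (simp add: X_def)
  have "(\<lambda>n. q ^ n * norm y) \<longlonglongrightarrow> 0"
    using assms by (intro tendsto_mult_left_zero LIMSEQ_realpow_zero)
  then have "(\<lambda>n. X n - y) \<longlonglongrightarrow> 0"
    by (rule Lim_null_comparison[rotated]) (simp add: err)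
  then show ?thesis unfolding X_def by (rule LIM_zero_cancel)
qed

text \<open>
  The estimate holds for all iterates from \<open>0\<close> and passes to the limit because the cone is closed. Instances
  are \<open>T / \<mu>\<close> for large \<open>\<mu>\<close> and multiples of resolvents; in both cases the fixed point is again a value of a resolvent.
\<close>

lemma fixed_point_abs_le:
  fixes A B :: "'a::banach_lattice complexification \<Rightarrow> 'a complexification"
  assumes lin: "linear A" "linear B"
    and bound: "\<And>x. norm (A x) \<le> q * norm x" "\<And>x. norm (B x) \<le> q * norm x" "0 \<le> q" "q < 1"
    and dom: "\<And>x w. \<bar>x\<bar> \<le> w \<Longrightarrow> \<bar>A x\<bar> \<le> B w"
    and y: "y = a + A y" and w: "w = b + B w" and ab: "\<bar>a\<bar> \<le> b"
  shows "\<bar>y\<bar> \<le> w"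
proof -
  define Y where "Y n = ((\<lambda>u. a + A u) ^^ n) 0" for n
  define W where "W n = ((\<lambda>u. b + B u) ^^ n) 0" for n
  have Y: "Y \<longlonglongrightarrow> y"
    unfolding Y_def by (rule contraction_iterates[OF lin(1) bound(1,3,4) y])
  have W: "W \<longlonglongrightarrow> w"
    unfolding W_def by (rule contraction_iterates[OF lin(2) bound(2,3,4) w])
  have YW: "\<bar>Y n\<bar> \<le> W n" for n
  proof (induction n)
    case (Suc n)
    have "\<bar>Y (Suc n)\<bar> \<le> \<bar>a\<bar> + \<bar>A (Y n)\<bar>"
      by (simp add: Y_def abs_complexification_triangle)
    also have "\<dots> \<le> b + B (W n)" using ab dom[OF Suc] by (rule add_mono)
    finally show ?case by (simp add: W_def)
  qed (simp add: Y_def W_def abs_of_nonneg_complexification)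
  have nonneg: "0 \<le> W n - \<bar>y\<bar> + \<bar>y - Y n\<bar>" for n
  proof -
    have "\<bar>y\<bar> \<le> \<bar>Y n\<bar> + \<bar>y - Y n\<bar>"
      using abs_complexification_triangle[of "Y n" "y - Y n"] by simp
    also have "\<dots> \<le> W n + \<bar>y - Y n\<bar>" using YW by simp
    finally show ?thesis by (simp add: algebra_simps)
  qed
  have "(\<lambda>n. W n - \<bar>y\<bar> + \<bar>y - Y n\<bar>) \<longlonglongrightarrow> w - \<bar>y\<bar> + 0"
  proof (intro tendsto_add tendsto_diff tendsto_const W)
    have "(\<lambda>n. norm \<bar>y - Y n\<bar>) \<longlonglongrightarrow> 0"
      using tendsto_norm[OF tendsto_diff[OF tendsto_const[of y] Y]]
      by (simp add: norm_abs_complexification)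
    then show "(\<lambda>n. \<bar>y - Y n\<bar>) \<longlonglongrightarrow> 0"
      by (rule tendsto_norm_zero_cancel)
  qed
  from LIMSEQ_nonneg_complexification[OF this nonneg] have "0 \<le> w - \<bar>y\<bar> + 0" .
  then show ?thesis by simp
qed

text \<open>
  By the resolvent identity \<open>u = R(s) y\<close> solves \<open>u = R(r) y + (r - s) R(r) u\<close>, and likewise on the ray through
  \<open>\<theta>\<close>. For \<open>s\<close> slightly below \<open>r\<close> both equations are contractions with positive \<open>r - s\<close>, so the
  domination at \<open>r\<close> is inherited.
\<close>

lemma resolvent_dominated_step:
  assumes spec: "of_real r \<notin> spectrum T" "of_real s \<notin> spectrum T"
      "of_real r * \<theta> \<notin> spectrum T" "of_real s * \<theta> \<notin> spectrum T"
    and \<theta>: "cmod \<theta> = 1" and "s \<le> r"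
    and small: "(r - s) * onorm (resolvent (of_real r) T) < 1"
      "(r - s) * onorm (resolvent (of_real r * \<theta>) T) < 1"
    and dom: "\<And>x y. \<bar>x\<bar> \<le> y \<Longrightarrow> \<bar>resolvent (of_real r * \<theta>) T x\<bar> \<le> resolvent (of_real r) T y"
    and xy: "\<bar>x\<bar> \<le> y"
  shows "\<bar>resolvent (of_real s * \<theta>) T x\<bar> \<le> resolvent (of_real s) T y"
proof -
  define A where "A = (\<lambda>u. (of_real (r - s) * \<theta>) *\<^sub>C resolvent (of_real r * \<theta>) T u)"
  define B where "B u = (r - s) *\<^sub>R resolvent (of_real r) T u" for u
  define q where "q = max ((r - s) * onorm (resolvent (of_real r) T)) ((r - s) * onorm (resolvent (of_real r * \<theta>) T))"
  note bl = resolvent_linear(1)[OF spec(1)] resolvent_linear(1)[OF spec(3)]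
  note lin = resolvent_linear(2)[OF spec(1)] resolvent_linear(2)[OF spec(3)]
  show ?thesis
  proof (rule fixed_point_abs_le)
    show "linear A"
      unfolding A_def by (intro linear_scaleC_comp resolvent_inverse(1) spec)
    show "linear B"
      by (rule linearI) (simp_all add: B_def linear_add[OF lin(1)] linear_cmul[OF lin(1)] algebra_simps)
    show "norm (A u) \<le> q * norm u" for u
    proof -
      have "norm (A u) \<le> (r - s) * (onorm (resolvent (of_real r * \<theta>) T) * norm u)"
        unfolding A_def norm_scaleC norm_mult using \<theta> \<open>s \<le> r\<close> onorm[OF bl(2), of u]
        by (simp add: mult_left_mono del: of_real_diff)
      also have "\<dots> \<le> q * norm u" unfolding mult.assoc[symmetric] by (rule mult_right_mono) (auto simp: q_def)
      finally show ?thesis .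
    qed
    show "norm (B u) \<le> q * norm u" for u
    proof -
      have "norm (B u) \<le> (r - s) * (onorm (resolvent (of_real r) T) * norm u)"
        unfolding B_def using \<open>s \<le> r\<close> onorm[OF bl(1), of u] by (simp add: mult_left_mono)
      also have "\<dots> \<le> q * norm u" unfolding mult.assoc[symmetric] by (rule mult_right_mono) (auto simp: q_def)
      finally show ?thesis .
    qed
    show "0 \<le> q" using \<open>s \<le> r\<close> onorm_pos_le[OF bl(1)] by (simp add: q_def le_max_iff_disj)
    show "q < 1" using small by (simp add: q_def)
    show "\<bar>A u\<bar> \<le> B w" if "\<bar>u\<bar> \<le> w" for u w
      using scaleR_left_mono[OF dom[OF that], of "r - s"] \<open>s \<le> r\<close> \<theta>
      by (simp add: A_def B_def abs_scaleC norm_mult del: of_real_diff)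
    show "resolvent (of_real s * \<theta>) T x = resolvent (of_real r * \<theta>) T x + A (resolvent (of_real s * \<theta>) T x)"
      using resolvent_identity[OF spec(3,4), of x] by (simp add: A_def algebra_simps)
    show "resolvent (of_real s) T y = resolvent (of_real r) T y + B (resolvent (of_real s) T y)"
      using resolvent_identity[OF spec(1,2), of y] by (simp add: B_def flip: scaleC_of_real)
    show "\<bar>resolvent (of_real r * \<theta>) T x\<bar> \<le> resolvent (of_real r) T y" by (rule dom[OF xy])
  qed
qed

lemma resolvent_dominated_large:
  assumes T: "bounded_clinear T" "positive_operator T"
    and r: "onorm T < r" and \<theta>: "cmod \<theta> = 1"
    and xy: "\<bar>x\<bar> \<le> y"
  shows "\<bar>resolvent (of_real r * \<theta>) T x\<bar> \<le> resolvent (of_real r) T y"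
proof -
  have bl: "bounded_linear T" using T by (simp add: bounded_clinear_def)
  note lin = bounded_linear.linear[OF bl]
  have r0: "0 < r" using r onorm_pos_le[OF bl] by simp
  have spec: "of_real r \<notin> spectrum T" "of_real r * \<theta> \<notin> spectrum T"
    using r0 r \<theta> by (auto intro!: spectrum_bounded[OF T(1)] simp: norm_mult)
  interpret vector_space scaleC by (rule vector_space_scaleC)
  have fix_eq: "u = inverse \<mu> *\<^sub>C f + inverse \<mu> *\<^sub>C T u" if "u = resolvent \<mu> T f" "\<mu> \<notin> spectrum T" "\<mu> \<noteq> 0" for u f \<mu>
  proof -
    have "\<mu> *\<^sub>C u = f + T u" using resolvent_inverse(3)[OF that(2), of f] that(1) by (simp add: algebra_simps)
    then have "inverse \<mu> *\<^sub>C \<mu> *\<^sub>C u = inverse \<mu> *\<^sub>C f + inverse \<mu> *\<^sub>C T u"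
      by (simp only: scale_right_distrib)
    then show ?thesis using that(3) by simp
  qed
  have nT: "norm (T u) / r \<le> onorm T / r * norm u" for u
    using divide_right_mono[OF onorm[OF bl, of u], of r] r0 by simp
  show ?thesis
  proof (rule fixed_point_abs_le)
    define A where "A = (\<lambda>u. inverse (of_real r * \<theta>) *\<^sub>C T u)"
    define B where "B u = inverse r *\<^sub>R T u" for u
    show "linear A"
      unfolding A_def by (rule linear_scaleC_comp[OF T(1)])
    show "linear B"
      by (rule linearI) (simp_all add: B_def linear_add[OF lin] linear_cmul[OF lin] algebra_simps)
    show "norm (A u) \<le> onorm T / r * norm u" "norm (B u) \<le> onorm T / r * norm u" for u
      using nT[of u] r0 \<theta> by (simp_all add: A_def B_def norm_scaleC norm_inverse norm_mult divide_inverse mult.commute)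
    show "0 \<le> onorm T / r" using onorm_pos_le[OF bl] r0 by simp
    show "onorm T / r < 1" using r r0 by simp
    show "\<bar>A u\<bar> \<le> B w" if "\<bar>u\<bar> \<le> w" for u w
    proof -
      have "\<bar>T u\<bar> \<le> T w"
        using positive_operator_abs_le[OF T] positive_operator_mono[OF T that] by (rule order_trans)
      then show ?thesis
        using scaleR_left_mono[of "\<bar>T u\<bar>" "T w" "inverse r"] r0 \<theta>
        by (simp add: A_def B_def abs_scaleC norm_mult norm_inverse)
    qed
    show "resolvent (of_real r * \<theta>) T x
        = inverse (of_real r * \<theta>) *\<^sub>C x + A (resolvent (of_real r * \<theta>) T x)"
      unfolding A_def using r0 \<theta> spec by (intro fix_eq[OF refl]) auto
    show "resolvent (of_real r) T y = inverse r *\<^sub>R y + B (resolvent (of_real r) T y)"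
      unfolding B_def using fix_eq[OF refl spec(1), of y] r0 by (simp flip: scaleC_of_real)
    show "\<bar>inverse (of_real r * \<theta>) *\<^sub>C x\<bar> \<le> inverse r *\<^sub>R y"
      using scaleR_left_mono[OF xy, of "inverse r"] r0 \<theta> by (simp add: abs_scaleC norm_mult norm_inverse)
  qed
qed

text \<open>
  The domination holds for all large \<open>s\<close>. It is then pushed down the ray in small steps: let \<open>t0\<close> be the infimum of
  the parameters above which it holds. If \<open>t0\<close> exceeded the spectral radius, the
  resolvents near \<open>t0\<close> would be uniformly bounded, and one step of uniform length would lead below \<open>t0\<close>. The
  argument needs no relation between the spectral radius and the norms of the powers of \<open>T\<close>.
\<close>

lemma resolvent_dominated:
  assumes T: "bounded_clinear T" "positive_operator T"
    and radius: "spectral_radius T < s" "0 \<le> spectral_radius T" and \<theta>: "cmod \<theta> = 1"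
    and xy: "\<bar>x\<bar> \<le> y"
  shows "\<bar>resolvent (of_real s * \<theta>) T x\<bar> \<le> resolvent (of_real s) T y"
proof -
  define \<rho> where "\<rho> = spectral_radius T"
  define D where "D t \<longleftrightarrow> (\<forall>x y. \<bar>x\<bar> \<le> y \<longrightarrow> \<bar>resolvent (of_real t * \<theta>) T x\<bar> \<le> resolvent (of_real t) T y)" for t :: real
  define G where "G = {t. \<rho> < t \<and> (\<forall>t'\<ge>t. D t')}"
  have spec: "of_real t \<notin> spectrum T" "of_real t * \<theta> \<notin> spectrum T" if "\<rho> < t" for t
    using that radius(2) \<theta> by (auto intro!: not_in_spectrum_of_radius_less[OF T(1)] simp: norm_mult \<rho>_def)
  have step: "D s" if "\<rho> < s" "s \<le> r" "D r" "(r - s) * onorm (resolvent (of_real r) T) < 1"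
    "(r - s) * onorm (resolvent (of_real r * \<theta>) T) < 1" for r s
    unfolding D_def
    using resolvent_dominated_step[OF spec(1)[of r] spec(1)[of s] spec(2)[of r] spec(2)[of s] \<theta>] that
    by (auto simp: D_def)
  have "max \<rho> (onorm T) + 1 \<in> G"
    using resolvent_dominated_large[OF T _ \<theta>] by (auto simp: G_def D_def)
  then have "G \<noteq> {}" by blast
  have bdd: "bdd_below G" by (rule bdd_belowI[of _ \<rho>]) (simp add: G_def)
  define t0 where "t0 = Inf G"
  have "\<rho> \<le> t0" unfolding t0_def using \<open>G \<noteq> {}\<close> by (intro cInf_greatest) (auto simp: G_def)
  have "t0 = \<rho>"
  proof (rule ccontr)
    assume "t0 \<noteq> \<rho>"
    with \<open>\<rho> \<le> t0\<close> have t0: "\<rho> < t0" by simp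
    define K where "K = max 1 (max (onorm (resolvent (of_real t0) T)) (onorm (resolvent (of_real t0 * \<theta>) T)))"
    \<comment> \<open>The resolvents between \<open>t0\<close> and \<open>t0 + \<delta>\<close> have norm at most \<open>2 K\<close>, so a step of length \<open>2 \<delta>\<close> is a contraction.\<close>
    define \<delta> where "\<delta> = min (1 / (8 * K)) ((t0 - \<rho>) / 2)"
    have K: "1 \<le> K" "onorm (resolvent (of_real t0) T) \<le> K" "onorm (resolvent (of_real t0 * \<theta>) T) \<le> K"
      by (simp_all add: K_def)
    have \<delta>: "0 < \<delta>" "\<delta> \<le> 1 / (8 * K)" "\<rho> < t0 - \<delta>"
      using K t0 by (auto simp: \<delta>_def min_def field_simps)
    have \<delta>K: "\<delta> * K \<le> 1 / 8" using \<delta>(2) K by (simp add: field_simps)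
    obtain r where r: "r \<in> G" "r < t0 + \<delta>"
      using cInf_lessD[OF \<open>G \<noteq> {}\<close>, of "t0 + \<delta>"] \<delta> by (auto simp: t0_def)
    have "t0 \<le> r" unfolding t0_def by (rule cInf_lower[OF r(1) bdd])
    have "\<rho> < r" "D r" using r by (auto simp: G_def)
    have near: "(r - t0) * K \<le> 1 / 8"
    proof -
      have "(r - t0) * K \<le> \<delta> * K" using r(2) K(1) by (intro mult_right_mono) auto
      then show ?thesis using \<delta>K by simp
    qed
    have "onorm (resolvent (of_real r) T) \<le> 2 * onorm (resolvent (of_real t0) T)"
    proof (intro onorm_resolvent_near spec t0 \<open>\<rho> < r\<close>)
      have "cmod (of_real t0 - of_real r) = r - t0" using \<open>t0 \<le> r\<close>
        by (metis abs_minus_commute abs_of_nonneg diff_ge_0_iff_ge norm_of_real of_real_diff)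
      then show "cmod (of_real t0 - of_real r) * onorm (resolvent (of_real t0) T) \<le> 1 / 2"
        using mult_left_mono[OF K(2), of "r - t0"] near \<open>t0 \<le> r\<close> by simp
    qed
    moreover have "onorm (resolvent (of_real r * \<theta>) T) \<le> 2 * onorm (resolvent (of_real t0 * \<theta>) T)"
    proof (intro onorm_resolvent_near spec t0 \<open>\<rho> < r\<close>)
      have "of_real t0 * \<theta> - of_real r * \<theta> = of_real (t0 - r) * \<theta>" by (simp add: algebra_simps)
      then have "cmod (of_real t0 * \<theta> - of_real r * \<theta>) = r - t0" using \<open>t0 \<le> r\<close> \<theta>
        by (simp add: norm_mult del: of_real_diff)
      then show "cmod (of_real t0 * \<theta> - of_real r * \<theta>) * onorm (resolvent (of_real t0 * \<theta>) T) \<le> 1 / 2"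
        using mult_left_mono[OF K(3), of "r - t0"] near \<open>t0 \<le> r\<close> by simp
    qed
    ultimately have rK: "onorm (resolvent (of_real r) T) \<le> 2 * K" "onorm (resolvent (of_real r * \<theta>) T) \<le> 2 * K"
      using K by auto
    have "D t'" if "t0 - \<delta> \<le> t'" for t'
    proof (cases "r \<le> t'")
      case True
      then show ?thesis using r(1) by (simp add: G_def)
    next
      case False
      have "(r - t') * c < 1" if "c \<le> 2 * K" for c
      proof -
        have "(r - t') * c \<le> (r - t') * (2 * K)" using that False by (intro mult_left_mono) auto
        also have "\<dots> \<le> (2 * \<delta>) * (2 * K)" using False K r(2) \<open>t0 - \<delta> \<le> t'\<close> by (intro mult_right_mono) auto
        finally show ?thesis using \<delta>K by simp
      qed
      then show ?thesis
        using False \<delta>(3) that \<open>D r\<close> rK by (intro step[of t' r]) auto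
    qed
    then have "t0 - \<delta> \<in> G" using \<delta> by (simp add: G_def)
    then have "t0 \<le> t0 - \<delta>" unfolding t0_def by (rule cInf_lower[OF _ bdd])
    with \<delta> show False by simp
  qed
  then obtain t where "t \<in> G" "t < s"
    using cInf_lessD[OF \<open>G \<noteq> {}\<close>, of s] radius(1) by (auto simp: t0_def \<rho>_def)
  then have "D s" by (auto simp: G_def)
  then show ?thesis using xy by (simp add: D_def)
qed

text \<open>
  Positivity is the case \<open>\<theta> = 1\<close> of the domination.
\<close>

lemma resolvent_nonneg:
  assumes T: "bounded_clinear T" "positive_operator T"
    and radius: "0 \<le> spectral_radius T" "spectral_radius T < r" and x: "0 \<le> x"
  shows "0 \<le> resolvent (of_real r) T x"
proof -
  have "\<bar>resolvent (of_real r * 1) T x\<bar> \<le> resolvent (of_real r) T x"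
    using x by (intro resolvent_dominated[OF T radius(2,1)]) (simp_all add: abs_of_nonneg_complexification)
  then show ?thesis using abs_complexification_nonneg order_trans by blast
qed

lemma resolvent_mono:
  assumes T: "bounded_clinear T" "positive_operator T"
    and radius: "0 \<le> spectral_radius T" "spectral_radius T < r" and xy: "x \<le> y"
  shows "resolvent (of_real r) T x \<le> resolvent (of_real r) T y"
proof -
  have "of_real r \<notin> spectrum T" using radius by (intro not_in_spectrum_of_radius_less[OF T(1)]) simp
  then have "resolvent (of_real r) T y - resolvent (of_real r) T x = resolvent (of_real r) T (y - x)"
    by (simp add: linear_diff[OF resolvent_linear(2)])
  also have "0 \<le> \<dots>" using xy by (intro resolvent_nonneg[OF T radius]) simp
  finally show ?thesis by simp
qed

text \<open>
  Both products equal \<open>(R(r) - R(s)) / (s - r)\<close>, and \<open>R(s) x\<close> is positive.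
\<close>

lemma resolvent_product_le:
  assumes T: "bounded_clinear T" "positive_operator T"
    and radius: "0 \<le> spectral_radius T" "spectral_radius T < r" "r < s" and x: "0 \<le> x"
  shows "(s - r) *\<^sub>R resolvent (of_real s) T (resolvent (of_real r) T x) \<le> resolvent (of_real r) T x"
    and "(s - r) *\<^sub>R resolvent (of_real r) T (resolvent (of_real s) T x) \<le> resolvent (of_real r) T x"
proof -
  have spec: "of_real r \<notin> spectrum T" "of_real s \<notin> spectrum T"
    using radius by (auto intro!: not_in_spectrum_of_radius_less[OF T(1)])
  have nonneg: "0 \<le> resolvent (of_real s) T x"
    using radius by (intro resolvent_nonneg[OF T radius(1) _ x]) simp
  have "resolvent (of_real r) T x = resolvent (of_real s) T x
      + (s - r) *\<^sub>R resolvent (of_real s) T (resolvent (of_real r) T x)"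
    using resolvent_identity[OF spec(2,1), of x] by (simp flip: scaleC_of_real)
  then show "(s - r) *\<^sub>R resolvent (of_real s) T (resolvent (of_real r) T x) \<le> resolvent (of_real r) T x"
    using nonneg by (metis add.commute le_add_same_cancel1)
  have "resolvent (of_real s) T x = resolvent (of_real r) T x
      + (r - s) *\<^sub>R resolvent (of_real r) T (resolvent (of_real s) T x)"
    using resolvent_identity[OF spec, of x] by (simp flip: scaleC_of_real)
  then have "(s - r) *\<^sub>R resolvent (of_real r) T (resolvent (of_real s) T x)
      = resolvent (of_real r) T x - resolvent (of_real s) T x"
    by (simp add: algebra_simps)
  then show "(s - r) *\<^sub>R resolvent (of_real r) T (resolvent (of_real s) T x) \<le> resolvent (of_real r) T x"
    using nonneg by simp
qed

section \<open>Powers of an element of a complex Banach lattice\<close>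

lemma abs_sin_int_mult_le: "\<bar>sin (of_int k * t)\<bar> \<le> \<bar>of_int k\<bar> * \<bar>sin t\<bar>" for t :: real
proof -
  have nat: "\<bar>sin (real n * t)\<bar> \<le> real n * \<bar>sin t\<bar>" for n
  proof (induction n)
    case (Suc n)
    have "\<bar>sin (real (Suc n) * t)\<bar> = \<bar>sin (real n * t) * cos t + cos (real n * t) * sin t\<bar>"
      by (simp add: algebra_simps sin_add)
    also have "\<dots> \<le> \<bar>sin (real n * t)\<bar> * \<bar>cos t\<bar> + \<bar>cos (real n * t)\<bar> * \<bar>sin t\<bar>"
      by (metis abs_mult abs_triangle_ineq)
    also have "\<dots> \<le> \<bar>sin (real n * t)\<bar> * 1 + 1 * \<bar>sin t\<bar>"
      by (intro add_mono mult_left_mono mult_right_mono) auto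
    finally show ?case using Suc.IH by (simp add: algebra_simps)
  qed simp
  show ?thesis
    using nat by (cases k rule: int_cases2) auto
qed

text \<open>
  The defect \<open>D\<^sub>n\<close> for \<open>n\<close> satisfies \<open>D\<^sub>n\<^sub>+\<^sub>1 = cos t D\<^sub>n + (n + 1) sin\<^sup>2 t sin (n t)\<close>.
\<close>

lemma abs_sin_cos_defect_le:
  fixes t :: real
  shows "\<bar>sin (of_int k * t) * cos t - of_int k * sin t * cos (of_int k * t)\<bar> \<le> (of_int k)\<^sup>2 * (sin t)\<^sup>2"
proof -
  define D where "D c = sin (c * t) * cos t - c * sin t * cos (c * t)" for c :: real
  have nat: "\<bar>D (real n)\<bar> \<le> (real n)\<^sup>2 * (sin t)\<^sup>2" for n
  proof (induction n)
    case (Suc n)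
    have "D (real (Suc n)) = cos t * D (real n) + (real n + 1) * (sin t)\<^sup>2 * sin (real n * t)"
    proof -
      have "real (Suc n) * t = real n * t + t" by (simp add: algebra_simps)
      then show ?thesis by (simp add: D_def sin_add cos_add algebra_simps power2_eq_square)
    qed
    also have "\<bar>\<dots>\<bar> \<le> \<bar>cos t\<bar> * \<bar>D (real n)\<bar> + ((real n + 1) * (sin t)\<^sup>2) * \<bar>sin (real n * t)\<bar>"
      by (rule order_trans[OF abs_triangle_ineq]) (simp add: abs_mult)
    also have "\<dots> \<le> 1 * \<bar>D (real n)\<bar> + ((real n + 1) * (sin t)\<^sup>2) * 1"
      by (intro add_mono mult_left_mono mult_right_mono) auto
    also have "\<dots> \<le> (real n)\<^sup>2 * (sin t)\<^sup>2 + (real n + 1) * (sin t)\<^sup>2"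
      using Suc.IH by simp
    also have "\<dots> = ((real n)\<^sup>2 + real n + 1) * (sin t)\<^sup>2"
      by (simp add: algebra_simps)
    also have "\<dots> \<le> (real (Suc n))\<^sup>2 * (sin t)\<^sup>2"
      by (intro mult_right_mono) (simp_all add: power2_eq_square algebra_simps)
    finally show ?case .
  qed (simp add: D_def)
  have "D (- c) = - D c" for c by (simp add: D_def)
  then have "\<bar>D (of_int k)\<bar> \<le> (of_int k)\<^sup>2 * (sin t)\<^sup>2"
    using nat by (cases k rule: int_cases2) auto
  then show ?thesis by (simp add: D_def)
qed

text \<open>
  For the function \<open>f(w) = \<bar>w\<bar> (w / \<bar>w\<bar>)\<^sup>k\<close>, the real linear functional \<open>w \<mapsto> Re (cnj (tangent_coeff k \<alpha> \<phi>) w)\<close> is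
  the derivative of \<open>Re (e\<^sup>i\<^sup>\<alpha> f)\<close> at the point \<open>cis \<phi>\<close>.
\<close>

definition tangent_coeff :: "int \<Rightarrow> real \<Rightarrow> real \<Rightarrow> complex" where
  "tangent_coeff k \<alpha> \<phi> = cis \<phi> * Complex (cos (of_int k * \<phi> + \<alpha>)) (- of_int k * sin (of_int k * \<phi> + \<alpha>))"

text \<open>
  This bound says that the lower approximation \<open>tangent\<^sub>\<phi> - N (\<bar>z\<bar> - Re (e\<^sup>-\<^sup>i\<^sup>\<phi> z))\<close> of a power never exceeds an upper
  approximation \<open>tangent\<^sub>\<psi> + N (\<bar>z\<bar> - Re (e\<^sup>-\<^sup>i\<^sup>\<psi> z))\<close>. Rotated by the mean of \<open>\<phi>\<close> and \<open>\<psi>\<close>, the sum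
  \<open>cis \<phi> + cis \<psi>\<close> becomes the real number \<open>2 cos t\<close> with \<open>t = (\<phi> - \<psi>) / 2\<close>. The difference of the
  coefficients has a real part of order \<open>sin\<^sup>2 t\<close> and an imaginary part of order \<open>sin t\<close>, and both are compensated
  by \<open>1 - cos\<^sup>2 t\<close>.
\<close>

lemma cmod_tangent_coeff_diff_le:
  fixes k :: int
  defines "N \<equiv> 3 * (1 + (of_int k)\<^sup>2) :: real"
  shows "cmod (tangent_coeff k \<alpha> \<phi> - tangent_coeff k \<alpha> \<psi> + of_real N * (cis \<phi> + cis \<psi>)) \<le> 2 * N"
proof -
  define m where "m = (\<phi> + \<psi>) / 2"
  define t where "t = (\<phi> - \<psi>) / 2"
  define \<beta> where "\<beta> = of_int k * m + \<alpha>"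
  define n where "n = (of_int k :: real)"
  have \<phi>: "\<phi> = m + t" and \<psi>: "\<psi> = m - t" by (simp_all add: m_def t_def field_simps)
  define D where "D = sin (n * t) * cos t - n * sin t * cos (n * t)"
  define F where "F = sin t * cos (n * t) - n * cos t * sin (n * t)"
  define w where "w = Complex (2 * N * cos t - 2 * sin \<beta> * D) (2 * cos \<beta> * F)"
  have eq: "tangent_coeff k \<alpha> \<phi> - tangent_coeff k \<alpha> \<psi> + of_real N * (cis \<phi> + cis \<psi>) = cis m * w"
  proof -
    have 1: "n * \<phi> + \<alpha> = \<beta> + n * t" "n * \<psi> + \<alpha> = \<beta> - n * t"
      by (simp_all add: \<phi> \<psi> \<beta>_def n_def algebra_simps)
    have 2: "cis \<phi> = cis m * cis t" "cis \<psi> = cis m * cis (- t)"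
      by (simp_all add: \<phi> \<psi> cis_mult)
    have "cis t * Complex (cos (\<beta> + n * t)) (- n * sin (\<beta> + n * t))
        - cis (- t) * Complex (cos (\<beta> - n * t)) (- n * sin (\<beta> - n * t))
        + of_real N * (cis t + cis (- t)) = w"
      by (simp add: complex_eq_iff w_def D_def F_def cos_add cos_diff sin_add sin_diff algebra_simps)
    then have "cis m * w = cis m * (cis t * Complex (cos (\<beta> + n * t)) (- n * sin (\<beta> + n * t))
        - cis (- t) * Complex (cos (\<beta> - n * t)) (- n * sin (\<beta> - n * t))
        + of_real N * (cis t + cis (- t)))" by simp
    then show ?thesis
      unfolding tangent_coeff_def n_def[symmetric] 1 unfolding 2 by (simp add: algebra_simps)
  qed
  define s where "s = \<bar>sin t\<bar>"
  define c where "c = \<bar>cos t\<bar>"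
  define P where "P = 1 + n\<^sup>2"
  have c: "0 \<le> c" "c \<le> 1" "c\<^sup>2 = 1 - s\<^sup>2"
    by (simp_all add: c_def s_def cos_squared_eq)
  have s: "0 \<le> s" "s \<le> 1" "s\<^sup>2 = (sin t)\<^sup>2" by (simp_all add: s_def)
  have P: "1 \<le> P" "n\<^sup>2 \<le> P" "N = 3 * P" by (simp_all add: P_def N_def n_def)
  have D: "\<bar>D\<bar> \<le> P * s\<^sup>2"
    using abs_sin_cos_defect_le[of k t] mult_right_mono[OF P(2), of "s\<^sup>2"] by (simp add: D_def n_def s)
  have F: "\<bar>F\<bar> \<le> P * s"
  proof -
    have "\<bar>F\<bar> \<le> \<bar>sin t\<bar> * \<bar>cos (n * t)\<bar> + \<bar>n\<bar> * \<bar>cos t\<bar> * \<bar>sin (n * t)\<bar>"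
      unfolding F_def by (rule order_trans[OF abs_triangle_ineq4]) (simp add: abs_mult)
    also have "\<dots> \<le> \<bar>sin t\<bar> * 1 + \<bar>n\<bar> * 1 * (\<bar>n\<bar> * \<bar>sin t\<bar>)"
      using abs_sin_int_mult_le[of k t] by (intro add_mono mult_mono) (auto simp: n_def)
    also have "\<dots> = P * s" by (simp add: P_def s_def algebra_simps power2_eq_square)
    finally show ?thesis .
  qed
  have "cmod w \<le> 2 * N"
  proof (rule power2_le_imp_le)
    have Re: "\<bar>Re w\<bar> \<le> 2 * N * \<bar>cos t\<bar> + 2 * (P * s\<^sup>2)"
    proof -
      have "\<bar>Re w\<bar> \<le> \<bar>2 * N * cos t\<bar> + \<bar>2 * sin \<beta> * D\<bar>" by (simp add: w_def)
      also have "\<bar>2 * sin \<beta> * D\<bar> \<le> 2 * 1 * (P * s\<^sup>2)"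
        unfolding abs_mult using D by (intro mult_mono) auto
      finally show ?thesis using P by (simp add: abs_mult)
    qed
    have Im: "\<bar>Im w\<bar> \<le> 2 * (P * s)"
    proof -
      have "\<bar>Im w\<bar> = 2 * \<bar>cos \<beta>\<bar> * \<bar>F\<bar>" by (simp add: w_def abs_mult)
      also have "\<dots> \<le> 2 * 1 * (P * s)" using F by (intro mult_mono) auto
      finally show ?thesis by simp
    qed
    have "(cmod w)\<^sup>2 = \<bar>Re w\<bar>\<^sup>2 + \<bar>Im w\<bar>\<^sup>2" by (simp add: cmod_power2)
    also have "\<dots> \<le> (2 * N * c + 2 * (P * s\<^sup>2))\<^sup>2 + (2 * (P * s))\<^sup>2"
      using Re Im unfolding c_def by (intro add_mono power_mono) auto
    also have "\<dots> = 4 * N\<^sup>2 * (1 - s\<^sup>2) + 4 * P\<^sup>2 * s\<^sup>2 * (6 * c + s\<^sup>2 + 1)"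
      unfolding c(3)[symmetric] P(3) by (simp add: power2_eq_square algebra_simps)
    also have "\<dots> \<le> 4 * N\<^sup>2 * (1 - s\<^sup>2) + 4 * P\<^sup>2 * s\<^sup>2 * (6 * 1 + 1 + 1)"
      using s(1,2) c by (intro add_left_mono mult_left_mono add_mono) (auto simp: power_le_one)
    \<comment> \<open>This is where \<open>N = 3 P\<close> is large enough: \<open>4 P\<^sup>2 \<cdot> 8 \<le> 4 N\<^sup>2\<close>.\<close>
    also have "\<dots> \<le> (2 * N)\<^sup>2"
      using mult_nonneg_nonneg[of "P\<^sup>2" "s\<^sup>2"] by (simp add: P(3) power2_eq_square algebra_simps)
    finally show "(cmod w)\<^sup>2 \<le> (2 * N)\<^sup>2" .
  qed (use P in simp)
  then show ?thesis by (simp add: eq norm_mult)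
qed

text \<open>
  A Banach lattice need not have suprema of infinite sets, but here \<open>Re w x + Im w y\<close> depends on \<open>w\<close> in a
  Lipschitz way, measured in multiples of \<open>\<bar>x\<bar> + \<bar>y\<bar>\<close>. Hence the suprema over finite nets of increasing fineness form a Cauchy sequence.
\<close>

lemma exists_lub_bounded_coeffs:
  fixes x y :: "'a::banach_lattice" and S :: "complex set"
  assumes S: "bounded S" "S \<noteq> {}"
  shows "\<exists>s. (\<forall>w\<in>S. Re w *\<^sub>R x + Im w *\<^sub>R y \<le> s) \<and>
    (\<forall>m. (\<forall>w\<in>S. Re w *\<^sub>R x + Im w *\<^sub>R y \<le> m) \<longrightarrow> s \<le> m)"
proof -
  define f where "f w = Re w *\<^sub>R x + Im w *\<^sub>R y" for w
  define u where "u = \<bar>x\<bar> + \<bar>y\<bar>"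
  have u0: "0 \<le> u" by (simp add: u_def add_nonneg_nonneg)
  have f_near: "f w \<le> f v + e *\<^sub>R u" if "dist w v \<le> e" for w v e
  proof -
    have "f w - f v = Re (w - v) *\<^sub>R x + Im (w - v) *\<^sub>R y"
      by (simp add: f_def algebra_simps)
    also have "\<dots> \<le> \<bar>Re (w - v)\<bar> *\<^sub>R \<bar>x\<bar> + \<bar>Im (w - v)\<bar> *\<^sub>R \<bar>y\<bar>"
      by (intro add_mono scaleR_le_abs_lattice)
    also have "\<dots> \<le> e *\<^sub>R \<bar>x\<bar> + e *\<^sub>R \<bar>y\<bar>"
      using order_trans[OF abs_Re_le_cmod[of "w - v"]] order_trans[OF abs_Im_le_cmod[of "w - v"]] that
      by (intro add_mono scaleR_right_mono) (simp_all only: dist_norm abs_ge_zero)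
    finally show ?thesis by (simp add: u_def algebra_simps)
  qed
  define d where "d n = inverse (real (Suc n))" for n
  have d_pos: "0 < d n" for n by (simp add: d_def)
  have d0: "d \<longlonglongrightarrow> 0" unfolding d_def by (rule LIMSEQ_inverse_real_of_nat)
  have "\<exists>K. finite K \<and> K \<noteq> {} \<and> K \<subseteq> S \<and> (\<forall>w\<in>S. \<exists>v\<in>K. dist w v \<le> d n)" for n
  proof -
    have "S \<subseteq> (\<Union>v\<in>S. ball v (d n))"
      using d_pos by auto
    have "compact (closure S)" using S(1) by simp
    moreover have "closure S \<subseteq> (\<Union>v\<in>S. ball v (d n))"
    proof
      fix w assume "w \<in> closure S"
      then obtain v where "v \<in> S" "dist v w < d n" using d_pos closure_approachable by blast
      then show "w \<in> (\<Union>v\<in>S. ball v (d n))" by auto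
    qed
    ultimately obtain K where K: "K \<subseteq> S" "finite K" "closure S \<subseteq> (\<Union>v\<in>K. ball v (d n))"
      using compactE_image[of "closure S" S "\<lambda>v. ball v (d n)"] by (metis open_ball)
    have "\<forall>w\<in>S. \<exists>v\<in>K. dist w v \<le> d n"
      using K(3) closure_subset[of S] by (force simp: dist_commute)
    moreover from this have "K \<noteq> {}" using S(2) by auto
    ultimately show ?thesis using K by blast
  qed
  then obtain K where K: "\<And>n. finite (K n)" "\<And>n. K n \<noteq> {}" "\<And>n. K n \<subseteq> S"
    "\<And>n w. w \<in> S \<Longrightarrow> \<exists>v\<in>K n. dist w v \<le> d n" by metis
  define s where "s n = Sup_fin (f ` K n)" for n
  have s_upper: "f w \<le> s n + d n *\<^sub>R u" if w: "w \<in> S" for w n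
  proof -
    obtain v where v: "v \<in> K n" "dist w v \<le> d n" using K(4)[OF w] by blast
    have "f v \<le> s n"
      unfolding s_def using K(1) v(1) by (intro Sup_fin.coboundedI) auto
    then show ?thesis using f_near[OF v(2)] by (meson add_right_mono order_trans)
  qed
  have s_least: "s n \<le> m" if "\<And>w. w \<in> S \<Longrightarrow> f w \<le> m" for n m
    unfolding s_def using K(1,2) that subsetD[OF K(3)] by (intro Sup_fin.boundedI) auto
  have s_le: "s m \<le> s n + d n *\<^sub>R u" for m n
    by (intro s_least s_upper)
  have norm_s: "norm (s m - s n) \<le> (d m + d n) * norm u" for m n
  proof -
    have "d n *\<^sub>R u \<le> (d m + d n) *\<^sub>R u" "d m *\<^sub>R u \<le> (d m + d n) *\<^sub>R u"
      using d_pos[of m] d_pos[of n] by (intro scaleR_right_mono u0; simp)+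
    then have "s m - s n \<le> (d m + d n) *\<^sub>R u" "s n - s m \<le> (d m + d n) *\<^sub>R u"
      using s_le[of m n] s_le[of n m] by (metis add.commute diff_le_eq order_trans)+
    then have "\<bar>s m - s n\<bar> \<le> (d m + d n) *\<^sub>R u" by (intro abs_leI) simp_all
    then have "norm \<bar>s m - s n\<bar> \<le> norm ((d m + d n) *\<^sub>R u)" by (intro norm_mono_nonneg) auto
    then show ?thesis using d_pos[of m] d_pos[of n] by (simp add: norm_abs)
  qed
  have "Cauchy s"
  proof (rule metric_CauchyI)
    fix e :: real assume "0 < e"
    have "(\<lambda>n. d n * norm u) \<longlonglongrightarrow> 0"
      using tendsto_mult_left_zero[OF d0] .
    then have "\<forall>\<^sub>F n in sequentially. d n * norm u < e / 2"
      using \<open>0 < e\<close> by (intro order_tendstoD(2)) auto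
    then obtain N where N: "\<And>n. n \<ge> N \<Longrightarrow> d n * norm u < e / 2"
      unfolding eventually_sequentially by blast
    have "dist (s m) (s n) < e" if "m \<ge> N" "n \<ge> N" for m n
      using norm_s[of m n] N[OF that(1)] N[OF that(2)] by (simp add: dist_norm distrib_right)
    then show "\<exists>M. \<forall>m\<ge>M. \<forall>n\<ge>M. dist (s m) (s n) < e" by blast
  qed
  then obtain l where l: "s \<longlonglongrightarrow> l" using Cauchy_convergent convergent_def by blast
  have "(\<lambda>n. s n + d n *\<^sub>R u) \<longlonglongrightarrow> l + 0 *\<^sub>R u"
    by (intro tendsto_intros l d0)
  then have "f w \<le> l" if "w \<in> S" for w
    using LIMSEQ_le_lattice[OF tendsto_const _ s_upper[OF that]] by simp
  moreover have "l \<le> m" if "\<And>w. w \<in> S \<Longrightarrow> f w \<le> m" for m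
    using LIMSEQ_le_lattice[OF l tendsto_const s_least[OF that]] .
  ultimately show ?thesis unfolding f_def by blast
qed

lemma scaleR_double: "(2 * c) *\<^sub>R x = c *\<^sub>R x + c *\<^sub>R x"
  for x :: "'a::real_vector"
  by (simp only: mult_2 scaleR_add_left)

text \<open>
  The element \<open>a\<close> plays the role of \<open>Re (e\<^sup>i\<^sup>\<alpha> z\<^sup>[\<^sup>k\<^sup>])\<close>. It is the supremum of the lower approximations, and
  it stays below the upper approximations because each of them bounds every lower one.
\<close>

lemma exists_real_power:
  fixes z :: "'a::banach_lattice complexification"
  shows "\<exists>a. \<forall>\<phi>. \<bar>a - re_part (dir_part (tangent_coeff k \<alpha> \<phi>) z)\<bar>
          \<le> (3 * (1 + (of_int k)\<^sup>2)) *\<^sub>R (cmodulus z - re_part (dir_part (cis \<phi>) z))"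
proof -
  define N :: real where "N = 3 * (1 + (of_int k)\<^sup>2)"
  have N: "0 \<le> N" by (simp add: N_def)
  define F where "F w = Re w *\<^sub>R re_part z + Im w *\<^sub>R im_part z" for w
  have F_add: "F (v + w) = F v + F w" and F_diff: "F (v - w) = F v - F w"
    and F_real: "F (of_real c * w) = c *\<^sub>R F w" for v w c
    by (simp_all add: F_def algebra_simps)
  define q where "q \<phi> = tangent_coeff k \<alpha> \<phi>" for \<phi>
  define p where "p \<phi> = q \<phi> + of_real N * cis \<phi>" for \<phi>
  have "cmod (p \<phi>) \<le> (1 + \<bar>of_int k\<bar>) + N" for \<phi>
  proof -
    have "cmod (q \<phi>) \<le> \<bar>cos (of_int k * \<phi> + \<alpha>)\<bar> + \<bar>of_int k\<bar> * \<bar>sin (of_int k * \<phi> + \<alpha>)\<bar>"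
      unfolding q_def tangent_coeff_def norm_mult
      using cmod_le[of "Complex (cos (of_int k * \<phi> + \<alpha>)) (- of_int k * sin (of_int k * \<phi> + \<alpha>))"]
      by (simp add: abs_mult)
    also have "\<dots> \<le> 1 + \<bar>of_int k\<bar> * 1" by (intro add_mono mult_left_mono) auto
    finally have "cmod (q \<phi>) \<le> 1 + \<bar>of_int k\<bar>" by simp
    then show ?thesis
      unfolding p_def using N by (intro order_trans[OF norm_triangle_ineq] add_mono) (simp_all add: norm_mult)
  qed
  then have bdd: "bounded (range p)" unfolding bounded_iff by (metis imageE)
  have ne: "range p \<noteq> {}" by simp
  obtain s where s: "\<And>\<phi>. F (p \<phi>) \<le> s" "\<And>m. (\<And>\<phi>. F (p \<phi>) \<le> m) \<Longrightarrow> s \<le> m"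
    using exists_lub_bounded_coeffs[OF bdd ne, of "re_part z" "im_part z"]
    unfolding F_def[symmetric] by auto
  have F_le: "F w \<le> c *\<^sub>R cmodulus z" if "cmod w \<le> c" for w c
    using cmodulus_upper_complex[of w z] scaleR_right_mono[OF that cmodulus_nonneg[of z]]
    unfolding F_def by (rule order_trans)
  have "\<bar>(s - N *\<^sub>R cmodulus z) - F (q \<phi>)\<bar> \<le> N *\<^sub>R (cmodulus z - F (cis \<phi>))" for \<phi>
  proof (rule abs_leI)
    have "s \<le> F (q \<phi>) - N *\<^sub>R F (cis \<phi>) + (2 * N) *\<^sub>R cmodulus z"
    proof (rule s(2))
      fix \<psi>
      have "F (q \<psi> - q \<phi> + of_real N * (cis \<psi> + cis \<phi>)) \<le> (2 * N) *\<^sub>R cmodulus z"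
        unfolding q_def N_def by (intro F_le cmod_tangent_coeff_diff_le)
      then show "F (p \<psi>) \<le> F (q \<phi>) - N *\<^sub>R F (cis \<phi>) + (2 * N) *\<^sub>R cmodulus z"
        unfolding p_def distrib_left F_add F_diff F_real by (simp add: algebra_simps)
    qed
    then show "(s - N *\<^sub>R cmodulus z) - F (q \<phi>) \<le> N *\<^sub>R (cmodulus z - F (cis \<phi>))"
      unfolding scaleR_double by (simp add: algebra_simps)
    show "- ((s - N *\<^sub>R cmodulus z) - F (q \<phi>)) \<le> N *\<^sub>R (cmodulus z - F (cis \<phi>))"
      using s(1)[of \<phi>] unfolding p_def F_add F_real by (simp add: algebra_simps)
  qed
  then show ?thesis unfolding F_def q_def N_def by auto
qed

text \<open>
  The phases \<open>0\<close> and \<open>- pi / 2\<close> select the real and the imaginary part of the linearisation at \<open>cis \<phi>\<close>.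
\<close>

definition tangent :: "int \<Rightarrow> real \<Rightarrow> 'a::banach_lattice complexification \<Rightarrow> 'a complexification" where
  "tangent k \<phi> z = dir_part (tangent_coeff k 0 \<phi>) z + \<i> *\<^sub>C dir_part (tangent_coeff k (- pi / 2) \<phi>) z"

text \<open>
  The elements \<open>v\<close> that behave like \<open>\<bar>z\<bar> (z / \<bar>z\<bar>)\<^sup>k\<close>: at each argument \<open>\<phi>\<close> the linearisation is a good approximation
  wherever \<open>z\<close> has an argument close to \<open>\<phi>\<close>. All properties of powers used below
  follow from this estimate by localisation.
\<close>

definition lattice_power ::
  "int \<Rightarrow> real \<Rightarrow> 'a::banach_lattice complexification \<Rightarrow> 'a complexification \<Rightarrow> bool" where
  "lattice_power k M z v \<longleftrightarrow> (\<forall>\<phi>. \<bar>v - tangent k \<phi> z\<bar> \<le> M *\<^sub>R (\<bar>z\<bar> - dir_part (cis \<phi>) z))"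

text \<open>
  The modulus is at most the sum of the moduli of the real and the imaginary part, which doubles the constant
  obtained for each part.
\<close>

lemma lattice_power_exists: "\<exists>v. lattice_power k (6 * (1 + (of_int k)\<^sup>2)) z v"
proof -
  define N :: real where "N = 3 * (1 + (of_int k)\<^sup>2)"
  obtain a b where
    a: "\<And>\<phi>. \<bar>a - re_part (dir_part (tangent_coeff k 0 \<phi>) z)\<bar>
          \<le> N *\<^sub>R (cmodulus z - re_part (dir_part (cis \<phi>) z))" and
    b: "\<And>\<phi>. \<bar>b - re_part (dir_part (tangent_coeff k (- pi / 2) \<phi>) z)\<bar>
          \<le> N *\<^sub>R (cmodulus z - re_part (dir_part (cis \<phi>) z))"
    using exists_real_power[of k _ z] unfolding N_def by meson
  have "\<bar>Cplx a b - tangent k \<phi> z\<bar> \<le> (2 * N) *\<^sub>R (\<bar>z\<bar> - dir_part (cis \<phi>) z)" for \<phi>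
  proof -
    have "cmodulus (Cplx a b - tangent k \<phi> z)
        \<le> N *\<^sub>R (cmodulus z - re_part (dir_part (cis \<phi>) z)) + N *\<^sub>R (cmodulus z - re_part (dir_part (cis \<phi>) z))"
      using add_mono[OF a[of \<phi>] b[of \<phi>]]
      by (intro order_trans[OF cmodulus_le]) (simp add: tangent_def)
    also have "\<dots> = (2 * N) *\<^sub>R (cmodulus z - re_part (dir_part (cis \<phi>) z))"
      by (simp only: scaleR_double)
    finally show ?thesis
      by (simp add: less_eq_complexification_def abs_complexification_def)
  qed
  then show ?thesis by (auto simp: lattice_power_def N_def)
qed

text \<open>
  The function \<open>\<bar>w\<bar> (w / \<bar>w\<bar>)\<^sup>k\<close> is homogeneous, so the component of its linearisation at \<open>cis \<phi>\<close> in the direction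
  \<open>cis (k \<phi>)\<close> is \<open>Re (cis (- \<phi>) w)\<close>.
\<close>

lemma dir_part_cis_le_abs_tangent: "dir_part (cis \<phi>) z \<le> \<bar>tangent k \<phi> z\<bar>"
proof -
  have coeff: "cis \<phi> = of_real (cos (of_int k * \<phi>)) * tangent_coeff k 0 \<phi>
      + of_real (sin (of_int k * \<phi>)) * tangent_coeff k (- pi / 2) \<phi>"
  proof -
    define c s where "c = cos (of_int k * \<phi>)" and "s = sin (of_int k * \<phi>)"
    have "c * c + s * s = 1" by (simp add: c_def s_def flip: power2_eq_square)
    then have "of_real c * Complex c (- of_int k * s) + of_real s * Complex s (of_int k * c) = 1"
      by (simp add: complex_eq_iff)
    then have "cis \<phi> = cis \<phi> * (of_real c * Complex c (- of_int k * s) + of_real s * Complex s (of_int k * c))"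
      by simp
    then show ?thesis
      by (simp add: tangent_coeff_def c_def s_def cos_diff sin_diff algebra_simps)
  qed
  have "dir_part (cis \<phi>) z = dir_part (cis (of_int k * \<phi>)) (tangent k \<phi> z)"
    by (subst coeff) (simp add: complexification_eq_iff tangent_def algebra_simps)
  also have "\<dots> \<le> \<bar>tangent k \<phi> z\<bar>" using dir_part_le[of "cis (of_int k * \<phi>)"] by simp
  finally show ?thesis .
qed

text \<open>
  The linearisation at \<open>\<phi>\<close> dominates \<open>dir_part (cis \<phi>) z\<close>, and localisation removes the error of the
  approximation.
\<close>

lemma lattice_power_abs_ge:
  assumes "lattice_power k M z v" "0 \<le> M"
  shows "\<bar>z\<bar> \<le> \<bar>v\<bar>"
proof -
  have "(1 + M) *\<^sub>R \<bar>z\<bar> \<le> \<bar>v\<bar> + M *\<^sub>R \<bar>z\<bar>"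
  proof (rule scaleR_abs_le_of_dir_part_le)
    fix \<phi>
    have "dir_part (cis \<phi>) z \<le> \<bar>tangent k \<phi> z\<bar>" by (rule dir_part_cis_le_abs_tangent)
    also have "\<dots> \<le> \<bar>v\<bar> + \<bar>v - tangent k \<phi> z\<bar>"
      using abs_complexification_triangle[of v "- (v - tangent k \<phi> z)"]
      unfolding abs_minus_complexification by simp
    also have "\<dots> \<le> \<bar>v\<bar> + M *\<^sub>R (\<bar>z\<bar> - dir_part (cis \<phi>) z)"
      using assms(1) by (simp add: lattice_power_def)
    finally show "(1 + M) *\<^sub>R dir_part (cis \<phi>) z \<le> \<bar>v\<bar> + M *\<^sub>R \<bar>z\<bar>"
      by (simp add: algebra_simps)
  qed (use assms(2) in simp)
  then show ?thesis by (simp add: algebra_simps)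
qed

lemma dir_part_scaleC: "dir_part w (c *\<^sub>C z) = dir_part (w * cnj c) z"
  by (simp add: complexification_eq_iff algebra_simps)

text \<open>
  The linearisations inherit the identity \<open>(e\<^sup>i\<^sup>\<tau> z)\<^sup>[\<^sup>k\<^sup>] = e\<^sup>i\<^sup>k\<^sup>\<tau> z\<^sup>[\<^sup>k\<^sup>]\<close>.
\<close>

lemma tangent_rotate:
  "tangent k (\<phi> + \<tau>) (cis \<tau> *\<^sub>C z) = cis (of_int k * \<tau>) *\<^sub>C tangent k \<phi> z"
proof -
  have shift: "tangent_coeff k \<alpha> (\<phi> + \<tau>) * cnj (cis \<tau>) = tangent_coeff k (of_int k * \<tau> + \<alpha>) \<phi>" for \<alpha>
  proof -
    have "cis (\<phi> + \<tau>) * cnj (cis \<tau>) = cis \<phi>" by (simp add: cis_cnj cis_mult)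
    then show ?thesis by (simp add: tangent_coeff_def algebra_simps)
  qed
  have rot: "tangent_coeff k \<beta> \<phi> = of_real (cos \<beta>) * tangent_coeff k 0 \<phi> - of_real (sin \<beta>) * tangent_coeff k (- pi / 2) \<phi>"
    "tangent_coeff k (\<beta> - pi / 2) \<phi> = of_real (cos \<beta>) * tangent_coeff k (- pi / 2) \<phi> + of_real (sin \<beta>) * tangent_coeff k 0 \<phi>" for \<beta>
    by (simp_all add: tangent_coeff_def complex_eq_iff cos_add sin_add cos_diff sin_diff algebra_simps)
  have "tangent k (\<phi> + \<tau>) (cis \<tau> *\<^sub>C z) = dir_part (tangent_coeff k (of_int k * \<tau>) \<phi>) z
      + \<i> *\<^sub>C dir_part (tangent_coeff k (of_int k * \<tau> - pi / 2) \<phi>) z"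
    by (simp add: tangent_def dir_part_scaleC shift)
  also have "\<dots> = cis (of_int k * \<tau>) *\<^sub>C tangent k \<phi> z"
    unfolding rot[of "of_int k * \<tau>"] tangent_def by (simp add: complexification_eq_iff algebra_simps)
  finally show ?thesis .
qed

text \<open>
  Applying \<open>T\<close> to the approximation of \<open>v\<close> by the linearisation at \<open>\<phi> + \<tau>\<close> approximates \<open>T v\<close> by \<open>\<omega>\<close> times the
  linearisation at \<open>\<phi>\<close>, because \<open>T z\<close> is a rotation of \<open>z\<close>. The latter also approximates \<open>\<omega> v\<close>, and
  the two errors add up to \<open>M (T \<bar>z\<bar> + \<bar>z\<bar> - 2 dir_part (cis \<phi>) z)\<close>. Localisation turns
  \<open>2 dir_part (cis \<phi>) z\<close> into \<open>2 \<bar>z\<bar>\<close>.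
\<close>

lemma lattice_power_almost_eigenvector:
  assumes T: "bounded_clinear T" "positive_operator T"
    and Tz: "T z = cis \<tau> *\<^sub>C z"
    and v: "lattice_power k M z v" "0 < M"
  shows "\<bar>T v - cis (of_int k * \<tau>) *\<^sub>C v\<bar> \<le> M *\<^sub>R (T \<bar>z\<bar> - \<bar>z\<bar>)"
proof -
  interpret vector_space scaleC by (rule vector_space_scaleC)
  note lin = bounded_clinear_linear[OF T(1)]
  define \<omega> where "\<omega> = cis (of_int k * \<tau>)"
  define y where "y = \<bar>T v - \<omega> *\<^sub>C v\<bar>"
  have "(2 * M) *\<^sub>R \<bar>z\<bar> \<le> M *\<^sub>R (T \<bar>z\<bar> + \<bar>z\<bar>) - y"
  proof (rule scaleR_abs_le_of_dir_part_le)
    fix \<phi>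
    define e where "e = v - tangent k (\<phi> + \<tau>) z"
    have "T (tangent k (\<phi> + \<tau>) z) = tangent k (\<phi> + \<tau>) (T z)"
      by (simp add: tangent_def linear_add[OF lin] bounded_clinear_scaleC[OF T(1)] positive_operator_dir_part[OF T])
    then have Te: "T e = T v - \<omega> *\<^sub>C tangent k \<phi> z"
      by (simp add: e_def linear_diff[OF lin] Tz tangent_rotate \<omega>_def)
    have "\<bar>T e\<bar> \<le> T \<bar>e\<bar>" by (rule positive_operator_abs_le[OF T])
    also have "\<dots> \<le> T (M *\<^sub>R (\<bar>z\<bar> - dir_part (cis (\<phi> + \<tau>)) z))"
      using v(1) by (intro positive_operator_mono[OF T]) (simp add: lattice_power_def e_def)
    also have "\<dots> = M *\<^sub>R (T \<bar>z\<bar> - dir_part (cis (\<phi> + \<tau>)) (cis \<tau> *\<^sub>C z))"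
      by (simp add: linear_cmul[OF lin] linear_diff[OF lin] positive_operator_dir_part[OF T] Tz)
    also have "dir_part (cis (\<phi> + \<tau>)) (cis \<tau> *\<^sub>C z) = dir_part (cis \<phi>) z"
      by (simp add: dir_part_scaleC cis_cnj cis_mult)
    finally have 1: "\<bar>T v - \<omega> *\<^sub>C tangent k \<phi> z\<bar> \<le> M *\<^sub>R (T \<bar>z\<bar> - dir_part (cis \<phi>) z)"
      by (simp add: Te)
    have "\<bar>\<omega> *\<^sub>C (v - tangent k \<phi> z)\<bar> \<le> M *\<^sub>R (\<bar>z\<bar> - dir_part (cis \<phi>) z)"
      using v(1) by (simp add: abs_scaleC \<omega>_def lattice_power_def)
    then have 2: "\<bar>- (\<omega> *\<^sub>C v - \<omega> *\<^sub>C tangent k \<phi> z)\<bar> \<le> M *\<^sub>R (\<bar>z\<bar> - dir_part (cis \<phi>) z)"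
      unfolding abs_minus_complexification by (simp add: scale_right_diff_distrib)
    have "y \<le> \<bar>T v - \<omega> *\<^sub>C tangent k \<phi> z\<bar> + \<bar>- (\<omega> *\<^sub>C v - \<omega> *\<^sub>C tangent k \<phi> z)\<bar>"
      unfolding y_def
      using abs_complexification_triangle[of "T v - \<omega> *\<^sub>C tangent k \<phi> z" "- (\<omega> *\<^sub>C v - \<omega> *\<^sub>C tangent k \<phi> z)"]
      by simp
    also note add_mono[OF 1 2]
    finally show "(2 * M) *\<^sub>R dir_part (cis \<phi>) z \<le> M *\<^sub>R (T \<bar>z\<bar> + \<bar>z\<bar>) - y"
      unfolding scaleR_double by (simp add: algebra_simps)
  qed (use v(2) in simp)
  then show ?thesis
    unfolding y_def \<omega>_def scaleR_double by (simp add: algebra_simps)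
qed

section \<open>Growth of the resolvent at the spectral radius\<close>

lemma abs_eigenvector_subinvariant:
  assumes T: "bounded_clinear T" "positive_operator T"
    and "T z = \<mu> *\<^sub>C z" "cmod \<mu> = 1"
  shows "\<bar>z\<bar> \<le> T \<bar>z\<bar>"
  using positive_operator_abs_le[OF T, of z] assms(3,4) by (simp add: abs_scaleC)

lemma resolvent_defect:
  assumes T: "bounded_clinear T" "positive_operator T" and radius: "spectral_radius T = 1" and r: "1 < r"
  shows "resolvent (of_real r) T (T x - x) = (r - 1) *\<^sub>R resolvent (of_real r) T x - x"
proof -
  have spec: "of_real r \<notin> spectrum T" using radius r by (intro not_in_spectrum_of_radius_less[OF T(1)]) simp
  note lin = resolvent_linear(2)[OF spec]
  have "T x - x = (r - 1) *\<^sub>R x - (of_real r *\<^sub>C x - T x)"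
    by (simp add: complexification_eq_iff algebra_simps)
  then have "resolvent (of_real r) T (T x - x) = resolvent (of_real r) T ((r - 1) *\<^sub>R x)
      - resolvent (of_real r) T (of_real r *\<^sub>C x - T x)"
    using linear_diff[OF lin] by metis
  then show ?thesis by (simp only: linear_cmul[OF lin] resolvent_inverse(2)[OF spec])
qed

lemma resolvent_abs_eigenvector_ge:
  assumes T: "bounded_clinear T" "positive_operator T" and radius: "spectral_radius T = 1"
    and z: "T z = \<mu> *\<^sub>C z" "cmod \<mu> = 1" and r: "1 < r"
  shows "\<bar>z\<bar> \<le> (r - 1) *\<^sub>R resolvent (of_real r) T \<bar>z\<bar>"
proof -
  have "0 \<le> resolvent (of_real r) T (T \<bar>z\<bar> - \<bar>z\<bar>)"
    using abs_eigenvector_subinvariant[OF T z] radius r by (intro resolvent_nonneg[OF T]) auto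
  then show ?thesis by (simp add: resolvent_defect[OF T radius r])
qed

text \<open>
  The term \<open>e\<close> is \<open>(r - 1) \<bar>R(r\<omega>) v\<bar>\<close> with \<open>v\<close> a \<open>k\<close>-th power of \<open>z\<close>; it is small since the resolvent is
  bounded near the regular value \<open>\<omega>\<close>.
\<close>

lemma regular_power_inequality:
  assumes T: "bounded_clinear T" "positive_operator T" and radius: "spectral_radius T = 1"
    and Tz: "T z = cis \<tau> *\<^sub>C z" and \<omega>: "cis (of_int k * \<tau>) \<notin> spectrum T"
  obtains M c \<delta> :: real where "0 < M" "0 \<le> c" "0 < \<delta>"
    and "\<And>r. 1 < r \<Longrightarrow> r < 1 + \<delta> \<Longrightarrow> \<exists>e. norm e \<le> c * (r - 1) \<and>
          (1 + M) *\<^sub>R \<bar>z\<bar> \<le> (M * (r - 1)) *\<^sub>R resolvent (of_real r) T \<bar>z\<bar> + e"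
proof -
  define M :: real where "M = 6 * (1 + (of_int k)\<^sup>2)"
  define \<omega> where "\<omega> = cis (of_int k * \<tau>)"
  have \<omega>1: "cmod \<omega> = 1" by (simp add: \<omega>_def)
  have M: "0 < M" unfolding M_def by (intro mult_pos_pos add_pos_nonneg) auto
  obtain v where v: "lattice_power k M z v" using lattice_power_exists unfolding M_def by blast
  define K where "K = onorm (resolvent \<omega> T)"
  note bl\<omega> = resolvent_linear(1)[OF \<omega>]
  have K: "0 \<le> K" unfolding K_def \<omega>_def by (rule onorm_pos_le[OF bl\<omega>])
  define \<delta> where "\<delta> = 1 / (2 * (K + 1))"
  show ?thesis
  proof (rule that[of M "2 * K * norm v" \<delta>])
    show "0 < M" "0 \<le> 2 * K * norm v" "0 < \<delta>" using M K by (simp_all add: \<delta>_def)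
    fix r :: real assume r: "1 < r" "r < 1 + \<delta>"
    have spec: "of_real r \<notin> spectrum T" "of_real r * \<omega> \<notin> spectrum T"
      using r radius \<omega>1 by (auto intro!: not_in_spectrum_of_radius_less[OF T(1)] simp: norm_mult)
    define S where "S = resolvent (of_real r * \<omega>) T"
    have S: "bounded_linear S" "linear S" "bounded_clinear S"
      unfolding S_def by (intro resolvent_linear resolvent_inverse(1) spec)+
    have onormS: "onorm S \<le> 2 * K"
      unfolding S_def K_def
    proof (rule onorm_resolvent_near[OF _ spec(2)])
      show "\<omega> \<notin> spectrum T" using \<omega> by (simp add: \<omega>_def)
      have "\<omega> - of_real r * \<omega> = of_real (1 - r) * \<omega>" by (simp add: algebra_simps)
      then have "cmod (\<omega> - of_real r * \<omega>) = r - 1" using r \<omega>1 by (simp add: norm_mult del: of_real_diff)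
      moreover have "(r - 1) * K \<le> \<delta> * K" using r K by (intro mult_right_mono) auto
      moreover have "\<delta> * K \<le> 1 / 2" using K by (simp add: \<delta>_def divide_simps)
      ultimately show "cmod (\<omega> - of_real r * \<omega>) * onorm (resolvent \<omega> T) \<le> 1 / 2"
        by (simp add: K_def)
    qed
    define w where "w = T v - \<omega> *\<^sub>C v"
    define e where "e = (r - 1) *\<^sub>R \<bar>S v\<bar>"
    have "norm e \<le> 2 * K * norm v * (r - 1)"
    proof -
      have "norm (S v) \<le> 2 * K * norm v"
        using onorm[OF S(1), of v] mult_right_mono[OF onormS, of "norm v"] by simp
      then show ?thesis
        using r mult_left_mono[of "norm (S v)" "2 * K * norm v" "r - 1"]
        by (simp add: e_def norm_abs_complexification mult.commute)
    qed
    moreover have "(1 + M) *\<^sub>R \<bar>z\<bar> \<le> (M * (r - 1)) *\<^sub>R resolvent (of_real r) T \<bar>z\<bar> + e"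
    proof -
      have "v = S ((of_real (r - 1) * \<omega>) *\<^sub>C v - w)"
      proof -
        have "(of_real r * \<omega>) *\<^sub>C v - T v = (of_real (r - 1) * \<omega>) *\<^sub>C v - w"
          by (simp add: complexification_eq_iff w_def algebra_simps)
        then show ?thesis using resolvent_inverse(2)[OF spec(2), of v] by (simp add: S_def)
      qed
      also have "\<dots> = (of_real (r - 1) * \<omega>) *\<^sub>C S v + - S w"
        by (simp add: linear_diff[OF S(2)] bounded_clinear_scaleC[OF S(3)])
      finally have "\<bar>v\<bar> \<le> \<bar>(of_real (r - 1) * \<omega>) *\<^sub>C S v\<bar> + \<bar>- S w\<bar>"
        using abs_complexification_triangle by metis
      also have "\<bar>(of_real (r - 1) * \<omega>) *\<^sub>C S v\<bar> = e"
        using r \<omega>1 by (simp add: abs_scaleC e_def norm_mult del: of_real_diff)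
      also have "\<bar>- S w\<bar> = \<bar>S w\<bar>" by (rule abs_minus_complexification)
      also have "\<bar>S w\<bar> \<le> resolvent (of_real r) T (M *\<^sub>R (T \<bar>z\<bar> - \<bar>z\<bar>))"
        unfolding S_def
      proof (rule resolvent_dominated[OF T _ _ \<omega>1])
        show "\<bar>w\<bar> \<le> M *\<^sub>R (T \<bar>z\<bar> - \<bar>z\<bar>)"
          unfolding w_def \<omega>_def by (rule lattice_power_almost_eigenvector[OF T Tz v M])
      qed (use radius r in simp_all)
      also have "resolvent (of_real r) T (M *\<^sub>R (T \<bar>z\<bar> - \<bar>z\<bar>))
          = M *\<^sub>R ((r - 1) *\<^sub>R resolvent (of_real r) T \<bar>z\<bar> - \<bar>z\<bar>)"
        by (simp only: linear_cmul[OF resolvent_linear(2)[OF spec(1)]] resolvent_defect[OF T radius r(1)])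
      finally have "\<bar>v\<bar> \<le> e + M *\<^sub>R ((r - 1) *\<^sub>R resolvent (of_real r) T \<bar>z\<bar> - \<bar>z\<bar>)"
        by simp
      with lattice_power_abs_ge[OF v] M
      have "\<bar>z\<bar> \<le> e + M *\<^sub>R ((r - 1) *\<^sub>R resolvent (of_real r) T \<bar>z\<bar> - \<bar>z\<bar>)"
        by (meson less_imp_le order_trans)
      then show ?thesis by (simp add: algebra_simps)
    qed
    ultimately show "\<exists>e. norm e \<le> 2 * K * norm v * (r - 1) \<and>
        (1 + M) *\<^sub>R \<bar>z\<bar> \<le> (M * (r - 1)) *\<^sub>R resolvent (of_real r) T \<bar>z\<bar> + e" by blast
  qed
qed

text \<open>
  The preceding inequality at \<open>r\<close> with \<open>R(s)\<close> applied to it. Which of \<open>r\<close> and \<open>s\<close> is larger is left open, because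
  the two growth conditions need opposite orders.
\<close>

lemma resolvent_norm_inequality:
  assumes T: "bounded_clinear T" "positive_operator T" and radius: "spectral_radius T = 1"
    and Tz: "T z = cis \<tau> *\<^sub>C z" and \<omega>: "cis (of_int k * \<tau>) \<notin> spectrum T"
  obtains M c \<delta> :: real where "0 < M" "0 \<le> c" "0 < \<delta>"
    and "\<And>r s. 1 < r \<Longrightarrow> r < 1 + \<delta> \<Longrightarrow> 1 < s \<Longrightarrow> r \<noteq> s \<Longrightarrow>
      (1 + M) * norm (resolvent (of_real s) T \<bar>z\<bar>)
        \<le> M * (r - 1) / \<bar>s - r\<bar> * norm (resolvent (of_real (min r s)) T \<bar>z\<bar>)
          + onorm (resolvent (of_real s) T) * (c * (r - 1))"
proof -
  obtain M c \<delta> :: real where M: "0 < M" "0 \<le> c" "0 < \<delta>"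
    and base: "\<And>r. 1 < r \<Longrightarrow> r < 1 + \<delta> \<Longrightarrow> \<exists>e. norm e \<le> c * (r - 1) \<and>
          (1 + M) *\<^sub>R \<bar>z\<bar> \<le> (M * (r - 1)) *\<^sub>R resolvent (of_real r) T \<bar>z\<bar> + e"
    using regular_power_inequality[OF T radius Tz \<omega>] by metis
  show ?thesis
  proof (rule that[OF M])
    fix r s :: real assume r: "1 < r" "r < 1 + \<delta>" and s: "1 < s" "r \<noteq> s"
    define x where "x = \<bar>z\<bar>"
    have x: "0 \<le> x" by (simp add: x_def abs_complexification_nonneg)
    obtain e where e: "norm e \<le> c * (r - 1)" "(1 + M) *\<^sub>R x \<le> (M * (r - 1)) *\<^sub>R resolvent (of_real r) T x + e"
      using base[OF r] by (auto simp: x_def)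
    have spec: "of_real s \<notin> spectrum T"
      using s radius by (intro not_in_spectrum_of_radius_less[OF T(1)]) simp
    note bl = resolvent_linear(1)[OF spec] and lin = resolvent_linear(2)[OF spec]
    define P where "P = resolvent (of_real s) T (resolvent (of_real r) T x)"
    have pos: "0 \<le> resolvent (of_real t) T y" if "1 < t" "0 \<le> y" for t y
      using that radius by (intro resolvent_nonneg[OF T]) auto
    have P: "\<bar>s - r\<bar> *\<^sub>R P \<le> resolvent (of_real (min r s)) T x"
      using resolvent_product_le(1)[OF T _ _ _ x, of r s] resolvent_product_le(2)[OF T _ _ _ x, of s r]
        r s radius by (cases "r < s") (auto simp: P_def min_def)
    have "norm P \<le> norm (resolvent (of_real (min r s)) T x) / \<bar>s - r\<bar>"
    proof -
      have "norm (\<bar>s - r\<bar> *\<^sub>R P) \<le> norm (resolvent (of_real (min r s)) T x)"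
        using P pos[OF s(1) pos[OF r(1) x]]
        by (intro norm_le_of_nonneg_le) (auto simp: P_def intro: scaleR_nonneg_nonneg)
      then show ?thesis using s(2) by (simp add: field_simps)
    qed
    then have nP: "M * (r - 1) * norm P \<le> M * (r - 1) / \<bar>s - r\<bar> * norm (resolvent (of_real (min r s)) T x)"
      using mult_left_mono[of "norm P" _ "M * (r - 1)"] M r by fastforce
    have "resolvent (of_real s) T ((1 + M) *\<^sub>R x)
        \<le> resolvent (of_real s) T ((M * (r - 1)) *\<^sub>R resolvent (of_real r) T x + e)"
      using s radius by (intro resolvent_mono[OF T _ _ e(2)]) auto
    then have le: "(1 + M) *\<^sub>R resolvent (of_real s) T x
        \<le> (M * (r - 1)) *\<^sub>R P + resolvent (of_real s) T e"
      by (simp only: linear_add[OF lin] linear_cmul[OF lin] P_def)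
    have "(1 + M) * norm (resolvent (of_real s) T x) = norm ((1 + M) *\<^sub>R resolvent (of_real s) T x)"
      using M by simp
    also have "\<dots> \<le> norm ((M * (r - 1)) *\<^sub>R P + resolvent (of_real s) T e)"
      using M le pos[OF s(1) x] by (intro norm_le_of_nonneg_le scaleR_nonneg_nonneg) auto
    also have "\<dots> \<le> M * (r - 1) * norm P + norm (resolvent (of_real s) T e)"
      using norm_triangle_ineq[of "(M * (r - 1)) *\<^sub>R P" "resolvent (of_real s) T e"] M r by simp
    also have "\<dots> \<le> M * (r - 1) / \<bar>s - r\<bar> * norm (resolvent (of_real (min r s)) T x)
        + onorm (resolvent (of_real s) T) * (c * (r - 1))"
      using onorm[OF bl, of e] mult_left_mono[OF e(1) onorm_pos_le[OF bl]]
      by (intro add_mono nP) linarith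
    finally show "(1 + M) * norm (resolvent (of_real s) T \<bar>z\<bar>)
        \<le> M * (r - 1) / \<bar>s - r\<bar> * norm (resolvent (of_real (min r s)) T \<bar>z\<bar>)
          + onorm (resolvent (of_real s) T) * (c * (r - 1))"
      by (simp add: x_def)
  qed
qed

text \<open>
  Letting \<open>n\<close> tend to infinity in the inequality improves any eventual upper bound \<open>L\<close> of \<open>(r\<^sub>n - 1) g\<^sub>n\<close> to the bound
  \<open>L M / (1 + M)\<close> for all indices. The supremum of these numbers is then nonpositive.
\<close>

lemma abel_bounded_contradiction:
  fixes r g K :: "nat \<Rightarrow> real"
  assumes r: "\<And>n. 1 < r n" "r \<longlonglongrightarrow> 1" and M: "0 < M" and "0 < \<delta>"
    and lower: "\<And>n. 1 \<le> (r n - 1) * g n"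
    and upper: "\<forall>\<^sub>F n in sequentially. (r n - 1) * g n \<le> C"
    and ineq: "\<And>m n. r n < r m \<Longrightarrow> r n < 1 + \<delta> \<Longrightarrow>
      (1 + M) * g m \<le> M * (r n - 1) / (r m - r n) * g n + K m * (r n - 1)"
  shows False
proof -
  define a where "a n = (r n - 1) * g n" for n
  have improve: "a m \<le> M / (1 + M) * L" if L: "\<forall>\<^sub>F n in sequentially. a n \<le> L" for L m
  proof -
    have near: "\<forall>\<^sub>F n in sequentially. r n < 1 + \<delta>"
      using \<open>0 < \<delta>\<close> by (intro order_tendstoD(2)[OF r(2)]) simp
    have ev: "\<forall>\<^sub>F n in sequentially. (1 + M) * g m \<le> M / (r m - r n) * L + K m * (r n - 1)"
      using L order_tendstoD(2)[OF r(2) r(1)[of m]] near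
    proof eventually_elim
      case (elim n)
      have "(1 + M) * g m \<le> M / (r m - r n) * a n + K m * (r n - 1)"
        using ineq[OF elim(2,3)] assms(4) by (simp add: a_def)
      also have "M / (r m - r n) * a n \<le> M / (r m - r n) * L"
        using elim M by (intro mult_left_mono) auto
      finally show ?case by simp
    qed
    have "(\<lambda>n. M / (r m - r n) * L + K m * (r n - 1)) \<longlonglongrightarrow> M / (r m - 1) * L + K m * (1 - 1)"
      using r(1)[of m] by (intro tendsto_intros r(2)) simp
    then have "(1 + M) * g m \<le> M / (r m - 1) * L + K m * (1 - 1)"
      by (rule tendsto_lowerbound[OF _ ev]) simp
    then have "(1 + M) * a m \<le> M * L"
      using r(1)[of m] by (simp add: a_def field_simps)
    then show ?thesis using M by (simp add: field_simps)
  qed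
  have bdd: "bdd_above (range a)"
    using improve[of C] upper by (intro bdd_aboveI[of _ "M / (1 + M) * C"]) (auto simp: a_def)
  define S where "S = (SUP n. a n)"
  have a_le: "a n \<le> S" for n unfolding S_def by (rule cSUP_upper[OF UNIV_I bdd])
  have "(SUP n. a n) \<le> M / (1 + M) * S"
    using improve[of S] a_le by (intro cSUP_least) simp_all
  then have "S \<le> M / (1 + M) * S" by (simp add: S_def)
  then have "S \<le> 0" using M by (simp add: field_simps)
  with a_le[of 0] lower[of 0] show False by (simp add: a_def)
qed

text \<open>
  Division by \<open>g\<^sub>n\<close> and \<open>n\<close> tending to infinity give \<open>1 \<le> C c (s - 1)\<close> for all \<open>s\<close> slightly above \<open>1\<close>.
\<close>

lemma maximal_growth_contradiction:
  fixes r g K :: "nat \<Rightarrow> real"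
  assumes r: "\<And>n. 1 < r n" "r \<longlonglongrightarrow> 1" and M: "0 < M" "0 \<le> c" "0 < \<delta>"
    and pos: "\<And>n. 0 < g n"
    and upper: "\<forall>\<^sub>F n in sequentially. K n \<le> C * g n"
    and ineq: "\<And>n s. r n < s \<Longrightarrow> s < 1 + \<delta> \<Longrightarrow>
      (1 + M) * g n \<le> M * (s - 1) / (s - r n) * g n + K n * (c * (s - 1))"
  shows False
proof -
  have lim: "1 + M \<le> M + C * (c * (s - 1))" if s: "1 < s" "s < 1 + \<delta>" for s
  proof -
    have ev: "\<forall>\<^sub>F n in sequentially. 1 + M \<le> M * (s - 1) / (s - r n) + C * (c * (s - 1))"
      using upper order_tendstoD(2)[OF r(2) s(1)]
    proof eventually_elim
      case (elim n)
      have "(1 + M) * g n \<le> M * (s - 1) / (s - r n) * g n + C * g n * (c * (s - 1))"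
        using ineq[OF elim(2) s(2)] mult_right_mono[OF elim(1), of "c * (s - 1)"] M s by simp
      also have "\<dots> = (M * (s - 1) / (s - r n) + C * (c * (s - 1))) * g n"
        by (simp add: algebra_simps)
      finally show ?case using pos[of n] by simp
    qed
    have "(\<lambda>n. M * (s - 1) / (s - r n) + C * (c * (s - 1))) \<longlonglongrightarrow> M * (s - 1) / (s - 1) + C * (c * (s - 1))"
      using s by (intro tendsto_intros r(2)) simp
    then have "1 + M \<le> M * (s - 1) / (s - 1) + C * (c * (s - 1))"
      by (rule tendsto_lowerbound[OF _ ev]) simp
    then show ?thesis using s by simp
  qed
  define \<epsilon> where "\<epsilon> = min (\<delta> / 2) (1 / (2 * (\<bar>C * c\<bar> + 1)))"
  have \<epsilon>: "0 < \<epsilon>" "\<epsilon> < \<delta>" using M by (auto simp: \<epsilon>_def)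
  have "1 \<le> C * c * \<epsilon>" using lim[of "1 + \<epsilon>"] \<epsilon> by (simp add: mult.assoc)
  also have "\<dots> \<le> \<bar>C * c\<bar> * (1 / (2 * (\<bar>C * c\<bar> + 1)))"
    using \<epsilon>(1) by (intro mult_mono) (auto simp: \<epsilon>_def)
  also have "\<dots> < 1" by (simp add: divide_simps)
  finally show False by simp
qed

theorem theorem1p1:
  fixes T :: "'a::banach_lattice complexification \<Rightarrow> 'a complexification"
    and \<mu> :: complex
    and z :: "'a complexification"
    and r :: "nat \<Rightarrow> real"
  assumes "bounded_clinear T"
    and "positive_operator T"
    and "spectral_radius T = 1"
    and "\<mu> \<in> peripheral_spectrum T"
    and "T z = \<mu> *\<^sub>C z"
    and "norm z = 1"
    and "\<forall>n. 1 < r n"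
    and "decseq r"
    and "r \<longlonglongrightarrow> 1"
  shows "(\<forall>n. 1 / (r n - 1) \<le> norm (resolvent (of_real (r n)) T \<bar>z\<bar>) \<and>
              norm (resolvent (of_real (r n)) T \<bar>z\<bar>) \<le> onorm (resolvent (of_real (r n)) T))
    \<and> (same_growth (\<lambda>n. norm (resolvent (of_real (r n)) T \<bar>z\<bar>)) (\<lambda>n. 1 / (r n - 1))
         \<longrightarrow> (\<forall>k::int. \<mu> powi k \<in> spectrum T))
    \<and> (same_growth (\<lambda>n. norm (resolvent (of_real (r n)) T \<bar>z\<bar>))
                    (\<lambda>n. onorm (resolvent (of_real (r n)) T))
         \<longrightarrow> (\<forall>k::int. \<mu> powi k \<in> spectrum T))"
proof -
  note T = assms(1,2) and radius = assms(3)
  have r: "1 < r n" for n using assms(7) by simp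
  have \<mu>1: "cmod \<mu> = 1" using assms(4) radius by (simp add: peripheral_spectrum_def)
  define \<tau> where "\<tau> = Arg \<mu>"
  have \<mu>: "\<mu> = cis \<tau>" using rcis_cmod_Arg[of \<mu>] \<mu>1 by (simp add: \<tau>_def rcis_def)
  have Tz: "T z = cis \<tau> *\<^sub>C z" using assms(5) \<mu> by simp
  have powi: "\<mu> powi k = cis (of_int k * \<tau>)" for k :: int
    by (simp add: \<mu> cis_power_int)
  define g where "g n = norm (resolvent (of_real (r n)) T \<bar>z\<bar>)" for n
  define K where "K n = onorm (resolvent (of_real (r n)) T)" for n
  have bl: "bounded_linear (resolvent (of_real (r n)) T)" for n
    using r[of n] radius by (intro resolvent_linear(1) not_in_spectrum_of_radius_less[OF T(1)]) simp
  have lower: "1 \<le> (r n - 1) * g n" for n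
    using norm_le_of_abs_le[of "\<bar>z\<bar>", OF order_trans[OF _ resolvent_abs_eigenvector_ge[OF T radius assms(5) \<mu>1 r[of n]]]]
      r[of n] assms(6) by (simp add: g_def norm_abs_complexification)
  have a: "1 / (r n - 1) \<le> g n \<and> g n \<le> K n" for n
    using lower[of n] r[of n] onorm[OF bl[of n], of "\<bar>z\<bar>"] assms(6)
    by (simp add: g_def K_def norm_abs_complexification field_simps)
  have g_pos: "0 < g n" for n
    using a[of n] r[of n] by (metis diff_gt_0_iff_gt divide_pos_pos less_le_trans zero_less_one)
  have b: "\<mu> powi k \<in> spectrum T" if "same_growth g (\<lambda>n. 1 / (r n - 1))" for k :: int
  proof (rule ccontr)
    assume "\<mu> powi k \<notin> spectrum T"
    then have \<omega>: "cis (of_int k * \<tau>) \<notin> spectrum T" by (simp add: powi)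
    obtain M c \<delta> :: real where M: "0 < M" "0 \<le> c" "0 < \<delta>"
      and ineq: "\<And>r s. 1 < r \<Longrightarrow> r < 1 + \<delta> \<Longrightarrow> 1 < s \<Longrightarrow> r \<noteq> s \<Longrightarrow>
        (1 + M) * norm (resolvent (of_real s) T \<bar>z\<bar>)
          \<le> M * (r - 1) / \<bar>s - r\<bar> * norm (resolvent (of_real (min r s)) T \<bar>z\<bar>)
            + onorm (resolvent (of_real s) T) * (c * (r - 1))"
      using resolvent_norm_inequality[OF T radius Tz \<omega>] by metis
    have "g \<in> O(\<lambda>n. 1 / (r n - 1))" using that by (simp add: same_growth_def)
    then obtain C where C: "\<forall>\<^sub>F n in sequentially. norm (g n) \<le> C * norm (1 / (r n - 1))"
      by (elim landau_o.bigE)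
    have upper: "\<forall>\<^sub>F n in sequentially. (r n - 1) * g n \<le> C"
      using C
    proof eventually_elim
      case (elim n)
      then show ?case using r[of n] g_pos[of n] by (simp add: field_simps)
    qed
    show False
    proof (rule abel_bounded_contradiction[OF r assms(9) M(1,3) lower upper])
      fix m n assume "r n < r m" "r n < 1 + \<delta>"
      then show "(1 + M) * g m \<le> M * (r n - 1) / (r m - r n) * g n + K m * c * (r n - 1)"
        using ineq[OF r[of n] _ r[of m]] by (simp add: g_def K_def mult.assoc min_def)
    qed
  qed
  have c: "\<mu> powi k \<in> spectrum T" if "same_growth g K" for k :: int
  proof (rule ccontr)
    assume "\<mu> powi k \<notin> spectrum T"
    then have \<omega>: "cis (of_int k * \<tau>) \<notin> spectrum T" by (simp add: powi)
    obtain M c \<delta> :: real where M: "0 < M" "0 \<le> c" "0 < \<delta>"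
      and ineq: "\<And>r s. 1 < r \<Longrightarrow> r < 1 + \<delta> \<Longrightarrow> 1 < s \<Longrightarrow> r \<noteq> s \<Longrightarrow>
        (1 + M) * norm (resolvent (of_real s) T \<bar>z\<bar>)
          \<le> M * (r - 1) / \<bar>s - r\<bar> * norm (resolvent (of_real (min r s)) T \<bar>z\<bar>)
            + onorm (resolvent (of_real s) T) * (c * (r - 1))"
      using resolvent_norm_inequality[OF T radius Tz \<omega>] by metis
    have "K \<in> O(g)" using that by (simp add: same_growth_def)
    then obtain C where C: "\<forall>\<^sub>F n in sequentially. norm (K n) \<le> C * norm (g n)"
      by (elim landau_o.bigE)
    have upper: "\<forall>\<^sub>F n in sequentially. K n \<le> C * g n"
      using C
    proof eventually_elim
      case (elim n)
      then show ?case using g_pos[of n] by simp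
    qed
    show False
    proof (rule maximal_growth_contradiction[OF r assms(9) M g_pos upper])
      fix n s assume "r n < s" "s < 1 + \<delta>"
      then show "(1 + M) * g n \<le> M * (s - 1) / (s - r n) * g n + K n * (c * (s - 1))"
        using ineq[of s "r n"] r[of n] by (simp add: g_def K_def min_def)
    qed
  qed
  show ?thesis using a b c unfolding g_def K_def by blast
qed

end
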